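(* Let $F:\mathbb{R}^d\to\mathbb{R}$ be bounded and $c>0$. Then: (i) $\|\partial^\beta\tilde F^c\|_\infty\le\|F\|_\infty\cdot(2c)^{|\beta|}$ for all multi-indices $\beta\in\mathbb{N}^d$; (ii) fix $x\in\mathbb{R}^d$; if $\varepsilon,\delta\ge0$ are such that $|F(x)-F(y)|\le\varepsilon$ whenever $\|x-y\|_2\le\delta$, then $|\tilde F^c(x)-F(x)|\le\varepsilon+\|F\|_\infty\cdot O(d^2/(c^2\delta^2))$, with an absolute implied constant.
   Context: Let $b:\mathbb{R}^d\to\mathbb{R}$ be $b(x)=\sqrt{C_d}(1-\|x\|_2^2)$ for $\|x\|_2<1$ and $b(x)=0$ otherwise, where $C_d>0$ is chosen so that $\|b\|_2=1$. Let $\hat b(t)=(2\pi)^{-d/2}\int_{\mathbb{R}^d}b(x)e^{-i\langle x,t\rangle}dx$ be its Fourier transform, $B=\hat b^2$, and $B_c(x)=c^d B(cx)$. The FT-mollification of $F$ is $\tilde F^c(x)=(B_c*F)(x)=\int_{\mathbb{R}^d}B_c(y)F(x-y)\,dy$. Multi-index notation: for $\beta\in\mathbb{N}^d$ ($\mathbb N$ the nonnegative integers), $|\beta|=\sum_i\beta_i$ and $\partial^\beta=\partial^{|\beta|}/\partial x_1^{\beta_1}\cdots\partial x_d^{\beta_d}$. *)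

theory Defs
  imports "HOL-Analysis.Analysis"
begin

text \<open>
  The implied constant in the main statement is uniform in the dimension \<open>d\<close>, so \<open>d\<close> has to be a
  natural number that can be quantified inside a formula, not a type. A vector of \<open>\<real>\<^sup>d\<close> is therefore an
  element of \<open>{..<d} \<rightarrow>\<^sub>E UNIV\<close>: a function that is \<open>undefined\<close> outside \<open>{..<d}\<close>. Its Euclidean
  norm is \<open>L2_set x {..<d}\<close>. Coordinates are numbered from \<open>0\<close>.
\<close>

abbreviation Rd :: "nat \<Rightarrow> (nat \<Rightarrow> real) set" where
  "Rd d \<equiv> {..<d} \<rightarrow>\<^sub>E UNIV"

text \<open>Lebesgue measure; the completion makes all Lebesgue measurable functions measurable.\<close>

definition leb :: "nat \<Rightarrow> (nat \<Rightarrow> real) measure" where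
  "leb d = completion (\<Pi>\<^sub>M i\<in>{..<d}. lborel)"

definition vsub :: "nat \<Rightarrow> (nat \<Rightarrow> real) \<Rightarrow> (nat \<Rightarrow> real) \<Rightarrow> (nat \<Rightarrow> real)" where
  "vsub d x y = (\<lambda>i\<in>{..<d}. x i - y i)"

definition vscale :: "nat \<Rightarrow> real \<Rightarrow> (nat \<Rightarrow> real) \<Rightarrow> (nat \<Rightarrow> real)" where
  "vscale d c x = (\<lambda>i\<in>{..<d}. c * x i)"

definition L2_norm :: "nat \<Rightarrow> ((nat \<Rightarrow> real) \<Rightarrow> real) \<Rightarrow> real" where
  "L2_norm d f = sqrt (\<integral>x. (f x)\<^sup>2 \<partial>leb d)"

text \<open>The supremum norm is extended-real valued, so that it is \<open>\<infinity>\<close> for unbounded functions.\<close>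

definition sup_norm :: "nat \<Rightarrow> ((nat \<Rightarrow> real) \<Rightarrow> real) \<Rightarrow> ereal" where
  "sup_norm d f = (SUP x\<in>Rd d. ereal \<bar>f x\<bar>)"

definition bump :: "nat \<Rightarrow> real \<Rightarrow> (nat \<Rightarrow> real) \<Rightarrow> real" where
  "bump d C x = (if L2_set x {..<d} < 1 then sqrt C * (1 - (L2_set x {..<d})\<^sup>2) else 0)"

definition C_const :: "nat \<Rightarrow> real" where
  "C_const d = (THE C. C > 0 \<and> L2_norm d (bump d C) = 1)"

definition b_fun :: "nat \<Rightarrow> (nat \<Rightarrow> real) \<Rightarrow> real" where
  "b_fun d = bump d (C_const d)"

definition fourier :: "nat \<Rightarrow> ((nat \<Rightarrow> real) \<Rightarrow> real) \<Rightarrow> (nat \<Rightarrow> real) \<Rightarrow> complex" where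
  "fourier d f t =
     complex_of_real ((2 * pi) powr (- (real d / 2))) *
     (\<integral>x. complex_of_real (f x) * exp (- (\<i> * complex_of_real (\<Sum>i<d. x i * t i))) \<partial>leb d)"

text \<open>As \<open>b_fun\<close> is even and real, its Fourier transform is real; \<open>Re\<close> is only a change of type.\<close>

definition B_fun :: "nat \<Rightarrow> (nat \<Rightarrow> real) \<Rightarrow> real" where
  "B_fun d t = Re ((fourier d (b_fun d) t)\<^sup>2)"

definition B_scaled :: "nat \<Rightarrow> real \<Rightarrow> (nat \<Rightarrow> real) \<Rightarrow> real" where
  "B_scaled d c x = c ^ d * B_fun d (vscale d c x)"

definition mollify :: "nat \<Rightarrow> real \<Rightarrow> ((nat \<Rightarrow> real) \<Rightarrow> real) \<Rightarrow> (nat \<Rightarrow> real) \<Rightarrow> real" where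
  "mollify d c F x = (\<integral>y. B_scaled d c y * F (vsub d x y) \<partial>leb d)"

definition partial :: "nat \<Rightarrow> ((nat \<Rightarrow> real) \<Rightarrow> real) \<Rightarrow> (nat \<Rightarrow> real) \<Rightarrow> real" where
  "partial i f x = deriv (\<lambda>s. f (x(i := s))) (x i)"

definition has_partial :: "nat \<Rightarrow> nat \<Rightarrow> ((nat \<Rightarrow> real) \<Rightarrow> real) \<Rightarrow> bool" where
  "has_partial d i f \<longleftrightarrow> (\<forall>x\<in>Rd d. (\<lambda>s. f (x(i := s))) differentiable at (x i))"

primrec has_partials :: "nat \<Rightarrow> nat list \<Rightarrow> ((nat \<Rightarrow> real) \<Rightarrow> real) \<Rightarrow> bool" where
  "has_partials d [] f \<longleftrightarrow> True"
| "has_partials d (i # is) f \<longleftrightarrow> has_partials d is f \<and> has_partial d i (foldr partial is f)"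

text \<open>
  A multi-index is \<open>\<beta> :: nat \<Rightarrow> nat\<close>, of which only the values at \<open>i < d\<close> are used. It is unfolded to
  the list of directions in which to differentiate, the outermost derivative first. Since
  \<open>deriv\<close> is total, existence of all the derivatives involved is the separate predicate
  \<open>has_multi_partial\<close>.
\<close>

definition dirs :: "nat \<Rightarrow> (nat \<Rightarrow> nat) \<Rightarrow> nat list" where
  "dirs d \<beta> = concat (map (\<lambda>i. replicate (\<beta> i) i) [0..<d])"

definition multi_partial ::
  "nat \<Rightarrow> (nat \<Rightarrow> nat) \<Rightarrow> ((nat \<Rightarrow> real) \<Rightarrow> real) \<Rightarrow> (nat \<Rightarrow> real) \<Rightarrow> real" where
  "multi_partial d \<beta> f = foldr partial (dirs d \<beta>) f"

definition has_multi_partial :: "nat \<Rightarrow> (nat \<Rightarrow> nat) \<Rightarrow> ((nat \<Rightarrow> real) \<Rightarrow> real) \<Rightarrow> bool" where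
  "has_multi_partial d \<beta> f \<longleftrightarrow> has_partials d (dirs d \<beta>) f"

end

theory Submission
  imports Defs "HOL-Probability.Characteristic_Functions"
begin

text \<open>
  Let \<open>FT(b)\<close> be the Fourier transform of \<open>b\<close>. By Plancherel,
  \<open>\<parallel>\<partial>\<^sup>\<alpha> FT(b)\<parallel>\<^sub>2 = \<parallel>x\<^sup>\<alpha> b\<parallel>\<^sub>2 \<le> \<parallel>b\<parallel>\<^sub>2 = 1\<close>, as \<open>b\<close> lives on the unit ball.
  The Leibniz rule splits \<open>\<partial>\<^sup>\<beta> B\<close> into \<open>2\<^bsup>|\<beta>|\<^esup>\<close> products of two such derivatives, so its \<open>L\<^sup>1\<close> norm is at
  most \<open>2\<^bsup>|\<beta>|\<^esup>\<close>; scaling and convolving with the bounded \<open>F\<close> gives (i). Also by Plancherel, \<open>B\<close> is a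
  probability density whose second moment is \<open>\<parallel>\<nabla>b\<parallel>\<^sub>2\<^sup>2\<close>. This is \<open>O(d\<^sup>2)\<close>, because \<open>b\<^sup>2\<close> is of order
  \<open>C\<^sub>d / d\<^sup>2\<close> on the concentric ball of radius \<open>1 - 1/(2d + 2)\<close>, which carries at least half of the volume.
  Markov's inequality then bounds the mass of \<open>B\<^sub>c\<close> outside the ball of radius \<open>\<delta>\<close>, which gives (ii).
\<close>

section \<open>Lebesgue measure on \<open>\<real>\<^sup>d\<close>\<close>

text \<open>\<open>b\<close> is Lipschitz but its gradient jumps across the unit sphere. Every
  estimate therefore rests on L^2 norms: of FT(b), of its derivatives, and of the transforms of the
  difference quotients of \<open>b\<close>. Plancherel is proved for bounded continuous functions of
  compact support, where a Gaussian weight makes each interchange of integrals absolutely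
  convergent. Transforms are kept as real cosine integrals with a phase, a class closed under
  differentiation. The implied constant is 2560 = 2 * 4 * 320: the second moment of \<open>B\<close>
  is at most 320 (d + 1)^2, then (d + 1)^2 \<le> 4 d^2 for d \<ge> 1, and the last factor 2 comes
  from |F(x) - F(y)| \<le> 2 sup |F|. \<open>F\<close> is only Lebesgue measurable, whereas the
  integrals are computed for the uncompleted product measure. Under the integral it is replaced by a
  Borel function, but in (ii) the value at the point \<open>x\<close> has to remain that of
  \<open>F\<close> itself.\<close>

abbreviation lborel_Rd :: "nat \<Rightarrow> (nat \<Rightarrow> real) measure" where
  "lborel_Rd d \<equiv> \<Pi>\<^sub>M i\<in>{..<d}. lborel"

abbreviation dot :: "nat \<Rightarrow> (nat \<Rightarrow> real) \<Rightarrow> (nat \<Rightarrow> real) \<Rightarrow> real" where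
  "dot d x t \<equiv> \<Sum>i<d. x i * t i"

text \<open>Translations, dilations and reflections are all of this form.\<close>

definition vaff :: "nat \<Rightarrow> (nat \<Rightarrow> real) \<Rightarrow> real \<Rightarrow> (nat \<Rightarrow> real) \<Rightarrow> nat \<Rightarrow> real" where
  "vaff d a s x = (\<lambda>i\<in>{..<d}. a i + s * x i)"

interpretation lborel_product: product_sigma_finite "\<lambda>_::nat. lborel :: real measure"
  by standard

lemma sigma_finite_lborel_Rd: "sigma_finite_measure (lborel_Rd d)"
  by (rule lborel_product.sigma_finite) simp

lemma pair_sigma_finite_lborel_Rd: "pair_sigma_finite (lborel_Rd d) (lborel_Rd d)"
  by (intro pair_sigma_finite.intro sigma_finite_lborel_Rd)

lemma vaff_apply [simp]: "i < d \<Longrightarrow> vaff d a s x i = a i + s * x i"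
  by (simp add: vaff_def)

lemma vaff_in_Rd [simp]: "vaff d a s x \<in> Rd d"
  by (auto simp: vaff_def)

text \<open>Joint measurability is what Fubini needs when the base point is an integration variable
  too, as in the Gaussian averages behind Plancherel.\<close>

lemma measurable_vaff_pair [measurable (raw)]:
  assumes a: "a \<in> M \<rightarrow>\<^sub>M lborel_Rd d" and [measurable]: "s \<in> borel_measurable M"
    and x: "x \<in> M \<rightarrow>\<^sub>M lborel_Rd d"
  shows "(\<lambda>w. vaff d (a w) (s w) (x w)) \<in> M \<rightarrow>\<^sub>M lborel_Rd d"
  unfolding vaff_def
proof (rule measurable_restrict)
  fix i assume "i \<in> {..<d}"
  then have "(\<lambda>w. a w i) \<in> M \<rightarrow>\<^sub>M lborel" "(\<lambda>w. x w i) \<in> M \<rightarrow>\<^sub>M lborel"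
    using measurable_compose[OF a measurable_component_singleton]
      measurable_compose[OF x measurable_component_singleton] by auto
  then have [measurable]: "(\<lambda>w. a w i) \<in> borel_measurable M" "(\<lambda>w. x w i) \<in> borel_measurable M"
    by simp_all
  show "(\<lambda>w. a w i + s w * x w i) \<in> M \<rightarrow>\<^sub>M lborel"
    by simp
qed

lemma measurable_vaff [measurable]: "vaff d a s \<in> lborel_Rd d \<rightarrow>\<^sub>M lborel_Rd d"
proof -
  \<comment> \<open>\<open>a\<close> may be any function, so it is first cut down to a point of the
    space; \<open>vaff\<close> reads only the coordinates below \<open>d\<close>.\<close>
  have [measurable]: "(\<lambda>i\<in>{..<d}. a i) \<in> space (lborel_Rd d)"
    by (simp add: space_PiM)
  have "(\<lambda>x. vaff d (\<lambda>i\<in>{..<d}. a i) s x) \<in> lborel_Rd d \<rightarrow>\<^sub>M lborel_Rd d"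
    by measurable
  moreover have "vaff d (\<lambda>i\<in>{..<d}. a i) s = vaff d a s"
    by (auto simp: vaff_def fun_eq_iff)
  ultimately show ?thesis
    by simp
qed

lemma component_measurable_lborel_Rd:
  assumes "x \<in> M \<rightarrow>\<^sub>M lborel_Rd d" "i < d"
  shows "(\<lambda>w. x w i) \<in> borel_measurable M"
  using measurable_compose[OF assms(1) measurable_component_singleton[of i "{..<d}" "\<lambda>_. lborel"]] assms(2)
  by simp

lemma dot_measurable [measurable (raw)]:
  assumes [measurable]: "x \<in> M \<rightarrow>\<^sub>M lborel_Rd d" "y \<in> M \<rightarrow>\<^sub>M lborel_Rd d"
  shows "(\<lambda>w. dot d (x w) (y w)) \<in> borel_measurable M"
  by (intro borel_measurable_sum borel_measurable_times component_measurable_lborel_Rd[where d=d]) (use assms in auto)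

text \<open>A product measure is determined by its boxes. The preimage of a box is a box, each side
  transforms by the one-dimensional affine rule, and the \<open>d\<close> factors multiply to the
  Jacobian.\<close>

lemma lborel_Rd_affine:
  assumes "s \<noteq> 0"
  shows "density (distr (lborel_Rd d) (lborel_Rd d) (vaff d a s)) (\<lambda>_. ennreal (\<bar>s\<bar> ^ d)) = lborel_Rd d"
proof (rule lborel_product.PiM_eqI)
  fix A :: "nat \<Rightarrow> real set" assume A: "\<And>i. i \<in> {..<d} \<Longrightarrow> A i \<in> sets lborel"
  have PiE: "Pi\<^sub>E {..<d} A \<in> sets (lborel_Rd d)"
    by (rule sets_PiM_I_finite) (use A in auto)
  have pre: "(\<lambda>x. a i + s * x) -` A i \<in> sets lborel" if "i < d" for i
    using measurable_sets[of "\<lambda>x. a i + s * x" borel borel "A i"] A[of i] that by simp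
  have eq: "vaff d a s -` Pi\<^sub>E {..<d} A \<inter> space (lborel_Rd d)
      = Pi\<^sub>E {..<d} (\<lambda>i. (\<lambda>x. a i + s * x) -` A i)"
    by (auto simp: space_PiM vaff_def PiE_iff extensional_def)
  have one: "ennreal \<bar>s\<bar> * emeasure lborel ((\<lambda>x. a i + s * x) -` A i) = emeasure lborel (A i)" if "i < d" for i
    using A[of i] that
    by (subst (2) lborel_real_affine[OF assms, of "a i"])
       (simp add: emeasure_density nn_integral_cmult emeasure_distr)
  have "emeasure (density (distr (lborel_Rd d) (lborel_Rd d) (vaff d a s)) (\<lambda>_. ennreal (\<bar>s\<bar> ^ d))) (Pi\<^sub>E {..<d} A)
      = ennreal (\<bar>s\<bar> ^ d) * emeasure (lborel_Rd d) (Pi\<^sub>E {..<d} (\<lambda>i. (\<lambda>x. a i + s * x) -` A i))"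
    using PiE by (simp add: emeasure_density nn_integral_cmult emeasure_distr eq)
  also have "\<dots> = (\<Prod>i<d. ennreal \<bar>s\<bar>) * (\<Prod>i<d. emeasure lborel ((\<lambda>x. a i + s * x) -` A i))"
    using pre by (subst lborel_product.emeasure_PiM) (auto simp: ennreal_power)
  also have "\<dots> = (\<Prod>i<d. emeasure lborel (A i))"
    unfolding prod.distrib[symmetric] by (intro prod.cong) (auto simp: one)
  finally show "emeasure (density (distr (lborel_Rd d) (lborel_Rd d) (vaff d a s)) (\<lambda>_. ennreal (\<bar>s\<bar> ^ d))) (Pi\<^sub>E {..<d} A)
      = (\<Prod>i<d. emeasure lborel (A i))" .
qed auto

lemma nn_integral_affine_Rd:
  assumes [measurable]: "h \<in> borel_measurable (lborel_Rd d)" and "s \<noteq> 0"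
  shows "ennreal (\<bar>s\<bar> ^ d) * (\<integral>\<^sup>+x. h (vaff d a s x) \<partial>lborel_Rd d) = (\<integral>\<^sup>+x. h x \<partial>lborel_Rd d)"
  by (subst (2) lborel_Rd_affine[OF \<open>s \<noteq> 0\<close>, of d a, symmetric])
     (simp add: nn_integral_density nn_integral_distr nn_integral_cmult)

lemma integral_affine_Rd:
  fixes h :: "(nat \<Rightarrow> real) \<Rightarrow> 'a :: {banach, second_countable_topology}"
  assumes [measurable]: "h \<in> borel_measurable (lborel_Rd d)" and "s \<noteq> 0"
  shows "(\<bar>s\<bar> ^ d) *\<^sub>R (\<integral>x. h (vaff d a s x) \<partial>lborel_Rd d) = (\<integral>x. h x \<partial>lborel_Rd d)"
  by (subst (2) lborel_Rd_affine[OF \<open>s \<noteq> 0\<close>, of d a, symmetric])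
     (simp add: integral_density integral_distr)

lemma AE_affine_Rd:
  assumes P: "AE x in lborel_Rd d. P x" and "s \<noteq> 0"
  shows "AE x in lborel_Rd d. P (vaff d a s x)"
proof -
  have "AE x in density (distr (lborel_Rd d) (lborel_Rd d) (vaff d a s)) (\<lambda>_. ennreal (\<bar>s\<bar> ^ d)). P x"
    unfolding lborel_Rd_affine[OF \<open>s \<noteq> 0\<close>] by (rule P)
  then have "AE x in distr (lborel_Rd d) (lborel_Rd d) (vaff d a s). P x"
    using \<open>s \<noteq> 0\<close> by (simp add: AE_density)
  then show ?thesis
    by (rule AE_distrD[rotated]) simp
qed

section \<open>The normalising constant of the bump\<close>

abbreviation sqnorm :: "nat \<Rightarrow> (nat \<Rightarrow> real) \<Rightarrow> real" where
  "sqnorm d x \<equiv> \<Sum>i<d. (x i)\<^sup>2"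

section \<open>Volumes of Euclidean balls\<close>

definition cball_Rd :: "nat \<Rightarrow> real \<Rightarrow> (nat \<Rightarrow> real) set" where
  "cball_Rd d r = {x \<in> Rd d. sqnorm d x \<le> r\<^sup>2}"

lemma sqnorm_nonneg: "0 \<le> sqnorm d x"
  by (intro sum_nonneg) auto

lemma sqnorm_measurable [measurable (raw)]:
  assumes [measurable]: "x \<in> M \<rightarrow>\<^sub>M lborel_Rd d"
  shows "(\<lambda>w. sqnorm d (x w)) \<in> borel_measurable M"
  by (intro borel_measurable_sum borel_measurable_power component_measurable_lborel_Rd[where d=d]) (use assms in auto)

lemma cball_Rd_sets [measurable, simp]: "cball_Rd d r \<in> sets (lborel_Rd d)"
proof -
  have "{x \<in> space (lborel_Rd d). sqnorm d x \<le> r\<^sup>2} \<in> sets (lborel_Rd d)"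
    by measurable
  then show ?thesis
    by (simp add: cball_Rd_def space_PiM)
qed

lemma abs_coord_le: "i < d \<Longrightarrow> sqnorm d x \<le> r\<^sup>2 \<Longrightarrow> 0 \<le> r \<Longrightarrow> \<bar>x i\<bar> \<le> r"
  by (rule power2_le_imp_le)
     (use member_le_sum[of i "{..<d}" "\<lambda>i. (x i)\<^sup>2"] in \<open>simp_all\<close>)

lemma emeasure_cball_Rd:
  assumes "0 < r"
  shows "emeasure (lborel_Rd d) (cball_Rd d r) = ennreal (r ^ d) * emeasure (lborel_Rd d) (cball_Rd d 1)"
proof -
  have "emeasure (lborel_Rd d) (cball_Rd d r) = (\<integral>\<^sup>+x. indicator (cball_Rd d r) x \<partial>lborel_Rd d)"
    by simp
  also have "\<dots> = ennreal (\<bar>r\<bar> ^ d) * (\<integral>\<^sup>+x. indicator (cball_Rd d r) (vaff d (\<lambda>_. 0) r x) \<partial>lborel_Rd d)"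
    by (rule nn_integral_affine_Rd[symmetric]) (use assms in auto)
  also have "(\<integral>\<^sup>+x. indicator (cball_Rd d r) (vaff d (\<lambda>_. 0) r x) \<partial>lborel_Rd d)
      = (\<integral>\<^sup>+x. indicator (cball_Rd d 1) x \<partial>lborel_Rd d)"
  proof (rule nn_integral_cong)
    fix x assume "x \<in> space (lborel_Rd d)"
    then have "x \<in> Rd d" by (simp add: space_PiM)
    moreover have "sqnorm d (vaff d (\<lambda>_. 0) r x) = r\<^sup>2 * sqnorm d x"
      by (simp add: power_mult_distrib sum_distrib_left)
    then have "sqnorm d (vaff d (\<lambda>_. 0) r x) \<le> r\<^sup>2 \<longleftrightarrow> sqnorm d x \<le> 1"
      using assms by simp
    ultimately show "indicator (cball_Rd d r) (vaff d (\<lambda>_. 0) r x) = (indicator (cball_Rd d 1) x :: ennreal)"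
      by (simp add: indicator_def cball_Rd_def)
  qed
  finally show ?thesis
    using assms by simp
qed

lemma emeasure_cball_Rd_finite: "emeasure (lborel_Rd d) (cball_Rd d r) < \<infinity>"
proof -
  have sub: "cball_Rd d r \<subseteq> (\<Pi>\<^sub>E i\<in>{..<d}. {-\<bar>r\<bar>..\<bar>r\<bar>})"
  proof
    fix x assume x: "x \<in> cball_Rd d r"
    then have "\<bar>x i\<bar> \<le> \<bar>r\<bar>" if "i < d" for i
      using abs_coord_le[OF that, of x "\<bar>r\<bar>"] by (simp add: cball_Rd_def)
    with x show "x \<in> (\<Pi>\<^sub>E i\<in>{..<d}. {-\<bar>r\<bar>..\<bar>r\<bar>})"
      by (auto simp: cball_Rd_def PiE_iff abs_le_iff) (smt (verit))+
  qed
  have "emeasure (lborel_Rd d) (cball_Rd d r) \<le> emeasure (lborel_Rd d) (\<Pi>\<^sub>E i\<in>{..<d}. {-\<bar>r\<bar>..\<bar>r\<bar>})"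
    by (rule emeasure_mono[OF sub]) (auto intro!: sets_PiM_I_finite)
  also have "\<dots> = (\<Prod>i<d. ennreal (2 * \<bar>r\<bar>))"
    by (subst lborel_product.emeasure_PiM) auto
  also have "\<dots> < \<infinity>"
    by (simp add: ennreal_power)
  finally show ?thesis .
qed

lemma emeasure_cball_Rd_pos: "0 < emeasure (lborel_Rd d) (cball_Rd d 1)"
proof -
  \<comment> \<open>A cube of half side \<open>r\<close> lies in the unit ball as soon as d r^2
    \<le> 1; this choice also covers \<open>d = 0\<close>.\<close>
  define r where "r = 1 / (real d + 1)"
  have r: "0 < r" "real d * r \<le> 1" "r \<le> 1" by (auto simp: r_def field_simps)
  have sub: "(\<Pi>\<^sub>E i\<in>{..<d}. {-r..r}) \<subseteq> cball_Rd d 1"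
  proof
    fix x assume x: "x \<in> (\<Pi>\<^sub>E i\<in>{..<d}. {-r..r})"
    then have "\<bar>x i\<bar> \<le> r" if "i < d" for i
      using PiE_mem[OF x, of i] that by (simp add: abs_le_iff)
    then have "(x i)\<^sup>2 \<le> r\<^sup>2" if "i < d" for i
      using that power_mono[of "\<bar>x i\<bar>" r 2] by simp
    then have "sqnorm d x \<le> (\<Sum>i<d. r\<^sup>2)"
      by (intro sum_mono) auto
    also have "\<dots> = (real d * r) * r" by (simp add: power2_eq_square)
    also have "\<dots> \<le> 1 * 1" using r by (intro mult_mono) auto
    finally show "x \<in> cball_Rd d 1"
      using x by (auto simp: cball_Rd_def PiE_iff)
  qed
  have "0 < (\<Prod>i<d. ennreal (2 * r))"
    using r by (simp add: ennreal_power)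
  also have "\<dots> = emeasure (lborel_Rd d) (\<Pi>\<^sub>E i\<in>{..<d}. {-r..r})"
    using r by (subst lborel_product.emeasure_PiM) auto
  also have "\<dots> \<le> emeasure (lborel_Rd d) (cball_Rd d 1)"
    by (rule emeasure_mono[OF sub]) simp
  finally show ?thesis .
qed

section \<open>Mass of the bump and the value of its constant\<close>

lemma bump_eq: "bump d C x = sqrt C * max 0 (1 - sqnorm d x)"
  by (auto simp: bump_def L2_set_def max_def sum_nonneg real_sqrt_pow2)

lemma bump_measurable [measurable (raw)]:
  assumes [measurable]: "x \<in> M \<rightarrow>\<^sub>M lborel_Rd d"
  shows "(\<lambda>w. bump d C (x w)) \<in> borel_measurable M"
  unfolding bump_eq by measurable

lemma bump_mass:
  fixes d :: nat
  defines "V \<equiv> emeasure (lborel_Rd d) (cball_Rd d 1)"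
  obtains I where "0 < I" "(\<integral>\<^sup>+x. ennreal ((max 0 (1 - sqnorm d x))\<^sup>2) \<partial>lborel_Rd d) = ennreal I"
    "V \<le> ennreal (8 * (real d + 1)\<^sup>2 * I)"
proof -
  let ?J = "\<integral>\<^sup>+x. ennreal ((max 0 (1 - sqnorm d x))\<^sup>2) \<partial>lborel_Rd d"
  \<comment> \<open>Bernoulli gives (1 - h)^d \<ge> 1 - d h \<ge> 1/2, while 1 - |x|^2 \<ge> h on
    the ball of radius 1 - h. The mass is thus at least h^2/2 times the volume, and 2/h^2 is the
    constant 8 (d + 1)^2.\<close>
  define h where "h = 1 / (2 * (real d + 1))"
  have h: "0 < h" "h \<le> 1/2" "real d * h \<le> 1/2" by (auto simp: h_def field_simps)
  have "?J \<le> (\<integral>\<^sup>+x. indicator (cball_Rd d 1) x \<partial>lborel_Rd d)"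
  proof (rule nn_integral_mono)
    fix x assume "x \<in> space (lborel_Rd d)"
    then have x: "x \<in> Rd d" by (simp add: space_PiM)
    have "(max 0 (1 - sqnorm d x))\<^sup>2 \<le> 1"
      using sqnorm_nonneg[of x d] by (intro power_le_one) auto
    with x show "ennreal ((max 0 (1 - sqnorm d x))\<^sup>2) \<le> indicator (cball_Rd d 1) x"
      by (cases "sqnorm d x \<le> 1") (simp_all add: cball_Rd_def)
  qed
  then have JV: "?J \<le> V" by (simp add: V_def)
  have bern: "1/2 \<le> (1 - h) ^ d"
    using Bernoulli_inequality[of "-h" d] h by (simp add: algebra_simps)
  have "ennreal (1/2) * V \<le> ennreal ((1 - h) ^ d) * V"
    using bern by (intro mult_right_mono ennreal_leI) auto
  also have "\<dots> = emeasure (lborel_Rd d) (cball_Rd d (1 - h))"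
    unfolding V_def using h by (intro emeasure_cball_Rd[symmetric]) auto
  finally have "ennreal (h\<^sup>2) * (ennreal (1/2) * V) \<le> ennreal (h\<^sup>2) * emeasure (lborel_Rd d) (cball_Rd d (1 - h))"
    by (rule mult_left_mono) simp
  also have "\<dots> = (\<integral>\<^sup>+x. ennreal (h\<^sup>2) * indicator (cball_Rd d (1 - h)) x \<partial>lborel_Rd d)"
    by (simp add: nn_integral_cmult)
  also have "\<dots> \<le> ?J"
  proof (rule nn_integral_mono)
    fix x
    show "ennreal (h\<^sup>2) * indicator (cball_Rd d (1 - h)) x \<le> ennreal ((max 0 (1 - sqnorm d x))\<^sup>2)"
    proof (cases "x \<in> cball_Rd d (1 - h)")
      case True
      then have "sqnorm d x \<le> (1 - h)\<^sup>2" by (simp add: cball_Rd_def)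
      also have "\<dots> \<le> (1 - h) * 1"
        unfolding power2_eq_square using h by (intro mult_left_mono) auto
      finally have "h \<le> 1 - sqnorm d x" by simp
      then show ?thesis
        using True h by (auto intro!: ennreal_leI power_mono)
    qed simp
  qed
  finally have VJ: "ennreal (h\<^sup>2 / 2) * V \<le> ?J"
    unfolding mult.assoc[symmetric] by (subst (asm) ennreal_mult[symmetric]) simp_all
  have "V < \<infinity>" using emeasure_cball_Rd_finite[of d 1] by (simp add: V_def)
  then obtain v where v: "V = ennreal v" "0 \<le> v" by (cases V) auto
  have "0 < v" using emeasure_cball_Rd_pos[of d] v by (auto simp: V_def)
  from JV v obtain I where I: "?J = ennreal I" "0 \<le> I" by (cases ?J) (auto simp: top_unique)
  have le: "h\<^sup>2 / 2 * v \<le> I"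
    using VJ v I by (simp add: ennreal_mult[symmetric])
  moreover have "0 < h\<^sup>2 / 2 * v" using h \<open>0 < v\<close> by simp
  ultimately have "0 < I" by simp
  moreover have "v \<le> 8 * (real d + 1)\<^sup>2 * I"
  proof -
    define e where "e = real d + 1"
    then have "e \<noteq> 0" by simp
    then have "v = 8 * (real d + 1)\<^sup>2 * (h\<^sup>2 / 2 * v)"
      unfolding h_def e_def[symmetric] by (simp add: power_divide power_mult_distrib)
    also have "\<dots> \<le> 8 * (real d + 1)\<^sup>2 * I"
      using le by (intro mult_left_mono) auto
    finally show ?thesis .
  qed
  ultimately show ?thesis
    using that I v by (simp add: ennreal_leI)
qed

text \<open>\<open>C_const\<close> is a definite description, so a unique solution has to be
  exhibited before anything can be said about it: the norm of the bump is sqrt (C I), which forces C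
  = 1/I. The volume bound later turns an integral of C_d over a ball into O(d^2).\<close>

lemma C_const_facts:
  shows C_const_pos: "0 < C_const d"
    and nn_integral_b_fun_square: "(\<integral>\<^sup>+x. ennreal ((b_fun d x)\<^sup>2) \<partial>lborel_Rd d) = 1"
    and C_const_volume: "ennreal (C_const d) * emeasure (lborel_Rd d) (cball_Rd d 1) \<le> ennreal (8 * (real d + 1)\<^sup>2)"
proof -
  obtain I where I: "0 < I" "(\<integral>\<^sup>+x. ennreal ((max 0 (1 - sqnorm d x))\<^sup>2) \<partial>lborel_Rd d) = ennreal I"
    "emeasure (lborel_Rd d) (cball_Rd d 1) \<le> ennreal (8 * (real d + 1)\<^sup>2 * I)"
    by (rule bump_mass)
  have nn: "(\<integral>\<^sup>+x. ennreal ((bump d C x)\<^sup>2) \<partial>lborel_Rd d) = ennreal (C * I)" if "0 < C" for C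
    using that I by (simp add: bump_eq power_mult_distrib ennreal_mult nn_integral_cmult)
  have L2: "L2_norm d (bump d C) = sqrt (C * I)" if "0 < C" for C
  proof -
    have "(\<integral>x. (bump d C x)\<^sup>2 \<partial>leb d) = (\<integral>x. (bump d C x)\<^sup>2 \<partial>lborel_Rd d)"
      unfolding leb_def by (rule integral_completion) measurable
    also have "\<dots> = C * I"
      using nn[OF that] that I by (subst integral_eq_nn_integral) auto
    finally show ?thesis by (simp add: L2_norm_def)
  qed
  have C: "C_const d = 1 / I"
    unfolding C_const_def
  proof (rule the_equality)
    show "0 < 1 / I \<and> L2_norm d (bump d (1 / I)) = 1"
      using I L2[of "1/I"] by simp
    fix C assume "0 < C \<and> L2_norm d (bump d C) = 1"
    then have "C * I = 1" using L2[of C] by auto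
    then show "C = 1 / I" using I by (simp add: field_simps)
  qed
  show "0 < C_const d" using C I by simp
  show "(\<integral>\<^sup>+x. ennreal ((b_fun d x)\<^sup>2) \<partial>lborel_Rd d) = 1"
    using nn[of "C_const d"] C I by (simp add: b_fun_def)
  have "ennreal (C_const d) * emeasure (lborel_Rd d) (cball_Rd d 1)
      \<le> ennreal (C_const d) * ennreal (8 * (real d + 1)\<^sup>2 * I)"
    by (intro mult_left_mono I) simp
  also have "\<dots> = ennreal (8 * (real d + 1)\<^sup>2)"
    using C I by (simp add: ennreal_mult[symmetric])
  finally show "ennreal (C_const d) * emeasure (lborel_Rd d) (cball_Rd d 1) \<le> ennreal (8 * (real d + 1)\<^sup>2)" .
qed

section \<open>Fourier integrals and Gaussians\<close>

declare sigma_finite_measure.borel_measurable_lebesgue_integral[OF sigma_finite_lborel_Rd, measurable (raw)]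

lemma pair_sigma_finite_lborel_Rd2:
  "pair_sigma_finite (lborel_Rd d) (lborel_Rd d \<Otimes>\<^sub>M lborel_Rd d)"
proof -
  interpret pair_sigma_finite "lborel_Rd d" "lborel_Rd d" by (rule pair_sigma_finite_lborel_Rd)
  show ?thesis
    by (intro pair_sigma_finite.intro sigma_finite_lborel_Rd sigma_finite_measure_axioms)
qed

lemma (in pair_sigma_finite) integrable_tensor:
  fixes f g :: "_ \<Rightarrow> real"
  assumes f: "integrable M1 f" and g: "integrable M2 g"
  shows "integrable (M1 \<Otimes>\<^sub>M M2) (\<lambda>(x, y). f x * g y)"
proof (rule Fubini_integrable)
  have [measurable]: "f \<in> borel_measurable M1" "g \<in> borel_measurable M2"
    using f g by auto
  show "(\<lambda>(x, y). f x * g y) \<in> borel_measurable (M1 \<Otimes>\<^sub>M M2)"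
    by measurable
  have "integrable M1 (\<lambda>x. \<bar>f x\<bar> * (\<integral>y. \<bar>g y\<bar> \<partial>M2))"
    using f by simp
  then show "integrable M1 (\<lambda>x. \<integral>y. norm (case (x, y) of (x, y) \<Rightarrow> f x * g y) \<partial>M2)"
    by (simp add: abs_mult)
  show "AE x in M1. integrable M2 (\<lambda>y. case (x, y) of (x, y) \<Rightarrow> f x * g y)"
    using g by simp
qed

lemma (in pair_sigma_finite) integral_tensor:
  fixes f g :: "_ \<Rightarrow> real"
  assumes f: "integrable M1 f" and g: "integrable M2 g"
  shows "(\<integral>w. f (fst w) * g (snd w) \<partial>(M1 \<Otimes>\<^sub>M M2)) = (\<integral>x. f x \<partial>M1) * (\<integral>y. g y \<partial>M2)"
  using integral_fst'[OF integrable_tensor[OF f g]]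
  by (simp add: case_prod_unfold)

text \<open>One real integral for both parts of the Fourier integral: phase 0 gives the real part,
  phase \<pi>/2 the imaginary part, because cos (s + \<pi>/2) = - sin s.\<close>

definition cos_int :: "nat \<Rightarrow> ((nat \<Rightarrow> real) \<Rightarrow> real) \<Rightarrow> real \<Rightarrow> (nat \<Rightarrow> real) \<Rightarrow> real" where
  "cos_int d f \<phi> t = (\<integral>x. f x * cos (dot d x t + \<phi>) \<partial>lborel_Rd d)"

definition ft_const :: "nat \<Rightarrow> real" where
  "ft_const d = (2 * pi) powr (- (real d / 2))"

lemma ft_const_pos: "0 < ft_const d"
  by (simp add: ft_const_def)

text \<open>The normalisation of the transform cancels the mass of the standard Gaussian; this is
  why Plancherel holds with constant 1.\<close>

lemma ft_const_sqrt: "ft_const d * sqrt (2 * pi) ^ d = 1"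
proof -
  have "sqrt (2 * pi) ^ d = (2 * pi) powr (real d / 2)"
    by (simp add: powr_half_sqrt[symmetric] powr_power)
  then show ?thesis
    by (simp add: ft_const_def powr_add[symmetric])
qed

lemma integrable_mult_cos:
  assumes f: "integrable (lborel_Rd d) f"
  shows "integrable (lborel_Rd d) (\<lambda>x. f x * cos (dot d x t + \<phi>))"
proof (rule Bochner_Integration.integrable_bound[OF f])
  have [measurable]: "f \<in> borel_measurable (lborel_Rd d)" using f by auto
  show "(\<lambda>x. f x * cos (dot d x t + \<phi>)) \<in> borel_measurable (lborel_Rd d)"
    by measurable
  show "AE x in lborel_Rd d. norm (f x * cos (dot d x t + \<phi>)) \<le> norm (f x)"
    by (auto simp: abs_mult intro!: mult_left_le)
qed

lemma cos_int_measurable [measurable (raw)]: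
  assumes [measurable]: "f \<in> borel_measurable (lborel_Rd d)" "t \<in> M \<rightarrow>\<^sub>M lborel_Rd d"
  shows "(\<lambda>w. cos_int d f \<phi> (t w)) \<in> borel_measurable M"
  unfolding cos_int_def by measurable

lemma cos_int_shift:
  assumes f: "integrable (lborel_Rd d) f"
  shows "cos_int d f \<phi> t = cos \<phi> * cos_int d f 0 t + sin \<phi> * cos_int d f (pi/2) t"
proof -
  have "cos_int d f \<phi> t = (\<integral>x. cos \<phi> * (f x * cos (dot d x t + 0)) + sin \<phi> * (f x * cos (dot d x t + pi/2)) \<partial>lborel_Rd d)"
    unfolding cos_int_def
    by (intro Bochner_Integration.integral_cong refl) (simp add: cos_add algebra_simps)
  also have "\<dots> = cos \<phi> * cos_int d f 0 t + sin \<phi> * cos_int d f (pi/2) t"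
    unfolding cos_int_def
    by (subst Bochner_Integration.integral_add)
       (use integrable_mult_cos[OF f, of t 0] integrable_mult_cos[OF f, of t "pi/2"] in simp_all)
  finally show ?thesis .
qed

lemma fourier_eq:
  assumes f: "integrable (lborel_Rd d) f"
  shows "fourier d f t = complex_of_real (ft_const d) * Complex (cos_int d f 0 t) (cos_int d f (pi/2) t)"
proof -
  have [measurable]: "f \<in> borel_measurable (lborel_Rd d)" using f by auto
  let ?h = "\<lambda>x. complex_of_real (f x) * exp (- (\<i> * complex_of_real (dot d x t)))"
  have h: "?h x = complex_of_real (f x * cos (dot d x t + 0)) + \<i> * complex_of_real (f x * cos (dot d x t + pi/2))" for x
    by (simp add: complex_eq_iff exp_Euler Re_exp Im_exp cos_add)
  have "?h \<in> borel_measurable (lborel_Rd d)"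
    unfolding h by measurable
  then have "(\<integral>x. ?h x \<partial>leb d) = (\<integral>x. ?h x \<partial>lborel_Rd d)"
    unfolding leb_def by (rule integral_completion)
  also have "\<dots> = complex_of_real (cos_int d f 0 t) + \<i> * complex_of_real (cos_int d f (pi/2) t)"
    unfolding h cos_int_def
    by (subst Bochner_Integration.integral_add)
       (use integrable_mult_cos[OF f, of t 0] integrable_mult_cos[OF f, of t "pi/2"] in
         \<open>auto simp del: of_real_mult intro!: integrable_mult_right\<close>)
  finally show ?thesis
    by (simp add: fourier_def ft_const_def complex_eq_iff)
qed

lemma cmod_fourier_square:
  assumes f: "integrable (lborel_Rd d) f"
  shows "(cmod (fourier d f t))\<^sup>2 = (ft_const d)\<^sup>2 * ((cos_int d f 0 t)\<^sup>2 + (cos_int d f (pi/2) t)\<^sup>2)"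
  by (simp add: fourier_eq[OF f] norm_mult power_mult_distrib cmod_power2 del: of_real_mult)

text \<open>The integral with phase \<phi> is the component of the vector (real part, imaginary
  part) in the direction (cos \<phi>, sin \<phi>), and a component is at most the length. L^2 bounds
  for complex transforms so pass to the real derivatives of FT(b).\<close>

lemma cos_int_le_fourier:
  assumes f: "integrable (lborel_Rd d) f"
  shows "(ft_const d * cos_int d f \<phi> t)\<^sup>2 \<le> (cmod (fourier d f t))\<^sup>2"
proof -
  let ?a = "cos_int d f 0 t" and ?b = "cos_int d f (pi/2) t"
  have "(cos \<phi> * ?a + sin \<phi> * ?b)\<^sup>2 + (sin \<phi> * ?a - cos \<phi> * ?b)\<^sup>2
      = ((sin \<phi>)\<^sup>2 + (cos \<phi>)\<^sup>2) * (?a\<^sup>2 + ?b\<^sup>2)"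
    by algebra
  then have "(cos \<phi> * ?a + sin \<phi> * ?b)\<^sup>2 \<le> ?a\<^sup>2 + ?b\<^sup>2"
    unfolding sin_cos_squared_add mult_1
    using zero_le_power2[of "sin \<phi> * ?a - cos \<phi> * ?b"] by linarith
  then show ?thesis
    unfolding cmod_fourier_square[OF f] cos_int_shift[OF f, of \<phi>] power_mult_distrib
    by (intro mult_left_mono) auto
qed

text \<open>Substituting u = \<epsilon> t turns the integrand into a multiple of the normal density
  times a character of frequency z/\<epsilon>, so the value is read off the characteristic function
  of the normal law.\<close>

lemma gaussian_integral_1:
  fixes \<epsilon> z :: real
  assumes "0 < \<epsilon>"
  shows "integrable lborel (\<lambda>t. complex_of_real (exp (- (\<epsilon> * t)\<^sup>2 / 2)) * iexp (z * t))" (is "integrable _ ?h")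
    and "(\<integral>t. complex_of_real (exp (- (\<epsilon> * t)\<^sup>2 / 2)) * iexp (z * t) \<partial>lborel)
      = complex_of_real (sqrt (2 * pi) / \<epsilon> * exp (- (z / \<epsilon>)\<^sup>2 / 2))"
proof -
  let ?g = "\<lambda>u. std_normal_density u *\<^sub>R iexp ((z / \<epsilon>) * u)"
  interpret real_distribution std_normal_distribution by (rule real_dist_normal_dist)
  have [measurable]: "(\<lambda>u. iexp ((z / \<epsilon>) * u)) \<in> borel_measurable borel" by measurable
  have "integrable std_normal_distribution (\<lambda>u. iexp ((z / \<epsilon>) * u))"
    by (rule integrable_iexp) simp_all
  then have g: "integrable lborel ?g"
    by (subst (asm) integrable_density) (auto simp: normal_density_nonneg)
  have "integral\<^sup>L lborel ?g = char std_normal_distribution (z / \<epsilon>)"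
    unfolding char_def by (subst integral_density) (auto simp: normal_density_nonneg)
  then have gi: "integral\<^sup>L lborel ?g = complex_of_real (exp (- (z / \<epsilon>)\<^sup>2 / 2))"
    by (simp add: char_std_normal_distribution)
  have gh: "complex_of_real (sqrt (2 * pi)) * ?g (0 + \<epsilon> * t) = ?h t" for t
    using assms by (simp add: std_normal_density_def scaleR_conv_of_real)
  have "integrable lborel (\<lambda>t. complex_of_real (sqrt (2 * pi)) * ?g (0 + \<epsilon> * t))"
    by (rule integrable_mult_right, rule lborel_integrable_real_affine[OF g]) (use assms in simp)
  then show "integrable lborel ?h" unfolding gh .
  have "(\<integral>t. ?h t \<partial>lborel) = complex_of_real (sqrt (2 * pi)) * (\<integral>t. ?g (0 + \<epsilon> * t) \<partial>lborel)"
    unfolding gh[symmetric] by (rule integral_mult_right_zero)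
  also have "(\<integral>t. ?g (0 + \<epsilon> * t) \<partial>lborel) = complex_of_real (exp (- (z / \<epsilon>)\<^sup>2 / 2)) / \<epsilon>"
    using lborel_integral_real_affine[of \<epsilon> ?g 0] assms gi
    by (simp add: scaleR_conv_of_real field_simps)
  finally show "(\<integral>t. ?h t \<partial>lborel) = complex_of_real (sqrt (2 * pi) / \<epsilon> * exp (- (z / \<epsilon>)\<^sup>2 / 2))"
    by simp
qed

text \<open>The cosine does not factor over the coordinates, but the complex exponential does; the
  claim is the real part of a product of one-dimensional integrals.\<close>

lemma gaussian_integral_Rd:
  fixes \<epsilon> :: real
  assumes "0 < \<epsilon>"
  shows "integrable (lborel_Rd d) (\<lambda>t. exp (- \<epsilon>\<^sup>2 * sqnorm d t / 2) * cos (dot d z t))"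
    and "(\<integral>t. exp (- \<epsilon>\<^sup>2 * sqnorm d t / 2) * cos (dot d z t) \<partial>lborel_Rd d)
      = (sqrt (2 * pi) / \<epsilon>) ^ d * exp (- sqnorm d z / (2 * \<epsilon>\<^sup>2))"
proof -
  let ?f = "\<lambda>i t. complex_of_real (exp (- (\<epsilon> * t)\<^sup>2 / 2)) * iexp (z i * t)"
  let ?h = "\<lambda>t. exp (- \<epsilon>\<^sup>2 * sqnorm d t / 2) * cos (dot d z t)"
  have E: "(\<Prod>i<d. exp (- (\<epsilon> * t i)\<^sup>2 / 2)) = exp (- \<epsilon>\<^sup>2 * sqnorm d t / 2)" for t
    by (simp add: exp_sum[symmetric] power_mult_distrib sum_negf sum_distrib_left sum_divide_distrib)
  have "(\<Prod>i<d. ?f i (t i)) = complex_of_real (exp (- \<epsilon>\<^sup>2 * sqnorm d t / 2)) * iexp (dot d z t)" for t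
    unfolding prod.distrib of_real_prod[symmetric] E
    by (simp add: exp_sum[symmetric] sum_distrib_left)
  then have P: "Re (\<Prod>i<d. ?f i (t i)) = ?h t" for t
    by (simp add: Re_exp)
  have int: "integrable (lborel_Rd d) (\<lambda>t. \<Prod>i<d. ?f i (t i))"
    by (rule lborel_product.product_integrable_prod) (use gaussian_integral_1[OF assms] in auto)
  then have "integrable (lborel_Rd d) (\<lambda>t. Re (\<Prod>i<d. ?f i (t i)))"
    by (rule integrable_Re)
  then show "integrable (lborel_Rd d) ?h" unfolding P .
  have "(\<integral>t. ?h t \<partial>lborel_Rd d) = Re (\<integral>t. (\<Prod>i<d. ?f i (t i)) \<partial>lborel_Rd d)"
    unfolding P[symmetric] using int by (rule integral_Re)
  also have "(\<integral>t. (\<Prod>i<d. ?f i (t i)) \<partial>lborel_Rd d) = (\<Prod>i<d. integral\<^sup>L lborel (?f i))"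
    by (rule lborel_product.product_integral_prod) (use gaussian_integral_1[OF assms] in auto)
  also have "\<dots> = complex_of_real (\<Prod>i<d. sqrt (2 * pi) / \<epsilon> * exp (- (z i / \<epsilon>)\<^sup>2 / 2))"
    unfolding of_real_prod by (intro prod.cong refl gaussian_integral_1(2)[OF assms])
  also have "(\<Prod>i<d. sqrt (2 * pi) / \<epsilon> * exp (- (z i / \<epsilon>)\<^sup>2 / 2))
      = (sqrt (2 * pi) / \<epsilon>) ^ d * exp (- sqnorm d z / (2 * \<epsilon>\<^sup>2))"
    unfolding prod.distrib
    by (simp add: exp_sum[symmetric] sum_negf sum_divide_distrib power_divide mult.commute)
  finally show "(\<integral>t. ?h t \<partial>lborel_Rd d) = (sqrt (2 * pi) / \<epsilon>) ^ d * exp (- sqnorm d z / (2 * \<epsilon>\<^sup>2))"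
    by simp
qed

section \<open>Plancherel's identity\<close>

text \<open>Continuity is sequential and looks only at the coordinates below \<open>d\<close>, which
  is the form that dominated convergence consumes. Boundedness and bounded support give
  integrability of \<open>f\<close> and of its square.\<close>

locale test_function =
  fixes d :: nat and f :: "(nat \<Rightarrow> real) \<Rightarrow> real" and M r :: real
  assumes meas [measurable]: "f \<in> borel_measurable (lborel_Rd d)"
    and bound: "\<And>x. \<bar>f x\<bar> \<le> M"
    and support: "\<And>x. x \<in> Rd d \<Longrightarrow> x \<notin> cball_Rd d r \<Longrightarrow> f x = 0"
    and cont: "\<And>X x. (\<And>i. i < d \<Longrightarrow> (\<lambda>n. X n i) \<longlonglongrightarrow> x i) \<Longrightarrow> (\<lambda>n. f (X n)) \<longlonglongrightarrow> f x"
begin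

lemma M_nonneg: "0 \<le> M"
  using bound[of "\<lambda>_. 0"] by linarith

lemma integrable: "integrable (lborel_Rd d) f"
proof (rule integrableI_bounded_set[where A="cball_Rd d r" and B=M])
  show "AE x in lborel_Rd d. x \<in> cball_Rd d r \<longrightarrow> norm (f x) \<le> M"
    using bound by simp
  show "AE x in lborel_Rd d. x \<notin> cball_Rd d r \<longrightarrow> f x = 0"
    using support by (auto simp: space_PiM)
qed (use emeasure_cball_Rd_finite in simp_all)

lemma integrable_square: "integrable (lborel_Rd d) (\<lambda>x. (f x)\<^sup>2)"
proof (rule Bochner_Integration.integrable_bound[where f="\<lambda>x. M * f x"])
  show "AE x in lborel_Rd d. norm ((f x)\<^sup>2) \<le> norm (M * f x)"
  proof (rule AE_I2)
    fix x
    show "norm ((f x)\<^sup>2) \<le> norm (M * f x)"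
      using mult_right_mono[OF bound[of x], of "\<bar>f x\<bar>"] M_nonneg by (simp add: abs_mult power2_eq_square)
  qed
qed (use integrable in simp_all)

text \<open>The products of the two cosine integrals and of the two sine integrals add up by the
  subtraction formula, so that \<open>t\<close> enters only through the difference of the two
  points. That is the form in which the Gaussian integral over \<open>t\<close> can be
  evaluated.\<close>

lemma cmod_fourier_square_double:
  "(cmod (fourier d f t))\<^sup>2 = (ft_const d)\<^sup>2 *
    (\<integral>w. f (fst w) * f (snd w) * cos (dot d (fst w) t - dot d (snd w) t) \<partial>(lborel_Rd d \<Otimes>\<^sub>M lborel_Rd d))"
proof -
  interpret W: pair_sigma_finite "lborel_Rd d" "lborel_Rd d" by (rule pair_sigma_finite_lborel_Rd)
  let ?c = "\<lambda>\<phi> x. f x * cos (dot d x t + \<phi>)"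
  have int: "integrable (lborel_Rd d \<Otimes>\<^sub>M lborel_Rd d) (\<lambda>w. ?c \<phi> (fst w) * ?c \<phi> (snd w))" for \<phi>
    using W.integrable_tensor[OF integrable_mult_cos[OF integrable] integrable_mult_cos[OF integrable], of t \<phi> t \<phi>]
    by (simp add: case_prod_unfold)
  have "(cos_int d f \<phi> t)\<^sup>2 = (\<integral>w. ?c \<phi> (fst w) * ?c \<phi> (snd w) \<partial>(lborel_Rd d \<Otimes>\<^sub>M lborel_Rd d))" for \<phi>
    unfolding power2_eq_square cos_int_def
    by (rule W.integral_tensor[symmetric]; rule integrable_mult_cos[OF integrable])
  then have "(cos_int d f 0 t)\<^sup>2 + (cos_int d f (pi/2) t)\<^sup>2
     = (\<integral>w. ?c 0 (fst w) * ?c 0 (snd w) + ?c (pi/2) (fst w) * ?c (pi/2) (snd w) \<partial>(lborel_Rd d \<Otimes>\<^sub>M lborel_Rd d))"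
    by (subst Bochner_Integration.integral_add[OF int int]) simp
  also have "\<dots> = (\<integral>w. f (fst w) * f (snd w) * cos (dot d (fst w) t - dot d (snd w) t) \<partial>(lborel_Rd d \<Otimes>\<^sub>M lborel_Rd d))"
    by (intro Bochner_Integration.integral_cong refl) (simp add: cos_add cos_diff algebra_simps)
  finally show ?thesis
    by (simp add: cmod_fourier_square[OF integrable])
qed

text \<open>Integrability of the squared transform is not known yet, hence the Gaussian weight: it
  allows Fubini, after which the integral over \<open>t\<close> is a Gaussian of width \<epsilon> in
  the difference of the two points.\<close>

lemma gaussian_mean_fourier:
  assumes e: "0 < \<epsilon>"
  shows "(\<integral>t. exp (- \<epsilon>\<^sup>2 * sqnorm d t / 2) * (cmod (fourier d f t))\<^sup>2 \<partial>lborel_Rd d)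
    = (\<integral>x. f x * (\<integral>u. f (vaff d x \<epsilon> u) * (ft_const d * exp (- sqnorm d u / 2)) \<partial>lborel_Rd d) \<partial>lborel_Rd d)"
proof -
  let ?L = "lborel_Rd d" and ?\<kappa> = "ft_const d"
  let ?W = "?L \<Otimes>\<^sub>M ?L"
  let ?E = "\<lambda>t. exp (- \<epsilon>\<^sup>2 * sqnorm d t / 2)"
  let ?ff = "\<lambda>w. f (fst w) * f (snd w)"
  let ?cos = "\<lambda>t w. cos (dot d (fst w) t - dot d (snd w) t)"
  interpret W: pair_sigma_finite ?L ?L by (rule pair_sigma_finite_lborel_Rd)
  interpret T: pair_sigma_finite ?L ?W by (rule pair_sigma_finite_lborel_Rd2)
  have intff: "integrable ?W ?ff"
    using W.integrable_tensor[OF integrable integrable] by (simp add: case_prod_unfold)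
  have intE: "integrable ?L ?E"
    using gaussian_integral_Rd(1)[OF e, of d "\<lambda>_. 0"] by simp
  have fst_snd [measurable]: "(\<lambda>p. fst (snd p)) \<in> ?L \<Otimes>\<^sub>M ?W \<rightarrow>\<^sub>M ?L" "(\<lambda>p. snd (snd p)) \<in> ?L \<Otimes>\<^sub>M ?W \<rightarrow>\<^sub>M ?L"
    by measurable
  have int: "integrable (?L \<Otimes>\<^sub>M ?W) (\<lambda>(t, w). ?E t * (?ff w * ?cos t w))"
  proof (rule Bochner_Integration.integrable_bound[OF T.integrable_tensor[OF intE intff]])
    show "(\<lambda>(t, w). ?E t * (?ff w * ?cos t w)) \<in> borel_measurable (?L \<Otimes>\<^sub>M ?W)"
      unfolding case_prod_unfold by measurable
    show "AE p in ?L \<Otimes>\<^sub>M ?W. norm (case p of (t, w) \<Rightarrow> ?E t * (?ff w * ?cos t w)) \<le> norm (case p of (t, w) \<Rightarrow> ?E t * ?ff w)"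
      by (auto simp: abs_mult intro!: AE_I2 mult_left_mono mult_left_le)
  qed
  have gauss: "(\<integral>t. ?E t * (?ff w * ?cos t w) \<partial>?L)
      = ?ff w * ((sqrt (2 * pi) / \<epsilon>) ^ d * exp (- (\<Sum>i<d. (fst w i - snd w i)\<^sup>2) / (2 * \<epsilon>\<^sup>2)))" for w
  proof -
    have "(\<integral>t. ?E t * (?ff w * ?cos t w) \<partial>?L) = (\<integral>t. ?ff w * (?E t * cos (dot d (\<lambda>i. fst w i - snd w i) t)) \<partial>?L)"
      by (intro Bochner_Integration.integral_cong refl) (simp add: left_diff_distrib sum_subtractf)
    also have "\<dots> = ?ff w * (\<integral>t. ?E t * cos (dot d (\<lambda>i. fst w i - snd w i) t) \<partial>?L)"
      by (rule integral_mult_right_zero)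
    finally show ?thesis
      by (simp only: gaussian_integral_Rd(2)[OF e])
  qed
  let ?K = "\<lambda>w. ?ff w * ((sqrt (2 * pi) / \<epsilon>) ^ d * exp (- (\<Sum>i<d. (fst w i - snd w i)\<^sup>2) / (2 * \<epsilon>\<^sup>2)))"
  have intK: "integrable ?W ?K"
    using T.integrable_snd[OF int] unfolding gauss .
  have "(\<integral>t. ?E t * (cmod (fourier d f t))\<^sup>2 \<partial>?L)
      = (\<integral>t. ?\<kappa>\<^sup>2 * (\<integral>w. ?E t * (?ff w * ?cos t w) \<partial>?W) \<partial>?L)"
    unfolding cmod_fourier_square_double
    by (intro Bochner_Integration.integral_cong refl) simp
  also have "\<dots> = ?\<kappa>\<^sup>2 * (\<integral>t. (\<integral>w. ?E t * (?ff w * ?cos t w) \<partial>?W) \<partial>?L)"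
    by (rule integral_mult_right_zero)
  also have "(\<integral>t. (\<integral>w. ?E t * (?ff w * ?cos t w) \<partial>?W) \<partial>?L) = (\<integral>w. (\<integral>t. ?E t * (?ff w * ?cos t w) \<partial>?L) \<partial>?W)"
    by (rule T.Fubini_integral[OF int, symmetric])
  also have "\<dots> = (\<integral>w. ?K w \<partial>?W)"
    unfolding gauss ..
  also have "\<dots> = (\<integral>x. (\<integral>y. ?K (x, y) \<partial>?L) \<partial>?L)"
    by (rule W.integral_fst'[OF intK, symmetric])
  also have "?\<kappa>\<^sup>2 * \<dots> = (\<integral>x. ?\<kappa>\<^sup>2 * (\<integral>y. ?K (x, y) \<partial>?L) \<partial>?L)"
    by (rule integral_mult_right_zero[symmetric])
  also have "\<dots> = (\<integral>x. f x * (\<integral>u. f (vaff d x \<epsilon> u) * (?\<kappa> * exp (- sqnorm d u / 2)) \<partial>?L) \<partial>?L)"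
  proof (intro Bochner_Integration.integral_cong refl)
    fix x assume "x \<in> space ?L"
    then have [measurable]: "x \<in> space ?L" .
    \<comment> \<open>Substitute y = x + \<epsilon> u; the Jacobian cancels the power of \<epsilon>
      in the Gaussian prefactor.\<close>
    have "(\<integral>y. ?K (x, y) \<partial>?L) = \<bar>\<epsilon>\<bar> ^ d *\<^sub>R (\<integral>u. ?K (x, vaff d x \<epsilon> u) \<partial>?L)"
    proof (rule integral_affine_Rd[symmetric])
      have "(\<lambda>y. y i) \<in> borel_measurable ?L" if "i < d" for i
        using component_measurable_lborel_Rd[of "\<lambda>x. x" ?L d i] that by simp
      then have [measurable]: "(\<lambda>y. (\<Sum>i<d. (x i - y i)\<^sup>2)) \<in> borel_measurable ?L"
        by (intro borel_measurable_sum borel_measurable_power borel_measurable_diff) auto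
      show "(\<lambda>y. ?K (x, y)) \<in> borel_measurable ?L"
        unfolding fst_conv snd_conv by measurable
    qed (use e in simp)
    also have "(\<integral>u. ?K (x, vaff d x \<epsilon> u) \<partial>?L)
        = (\<integral>u. (f x * (sqrt (2 * pi) / \<epsilon>) ^ d) * (f (vaff d x \<epsilon> u) * exp (- sqnorm d u / 2)) \<partial>?L)"
      using e by (intro Bochner_Integration.integral_cong refl)
        (simp add: power_mult_distrib sum_distrib_left[symmetric])
    also have "\<dots> = (f x * (sqrt (2 * pi) / \<epsilon>) ^ d) * (\<integral>u. f (vaff d x \<epsilon> u) * exp (- sqnorm d u / 2) \<partial>?L)"
      by (rule integral_mult_right_zero)
    \<comment> \<open>\<open>ft_const\<close> occurs squared: one factor cancels the power of sqrt
      (2 \<pi>), the other makes the Gaussian in \<open>u\<close> a probability density.\<close>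
    finally have "?\<kappa>\<^sup>2 * (\<integral>y. ?K (x, y) \<partial>?L)
        = (?\<kappa> * sqrt (2 * pi) ^ d) * f x * (?\<kappa> * (\<integral>u. f (vaff d x \<epsilon> u) * exp (- sqnorm d u / 2) \<partial>?L))"
      using e by (simp add: power_divide power2_eq_square)
    also have "\<dots> = f x * (?\<kappa> * (\<integral>u. f (vaff d x \<epsilon> u) * exp (- sqnorm d u / 2) \<partial>?L))"
      by (simp add: ft_const_sqrt)
    also have "?\<kappa> * (\<integral>u. f (vaff d x \<epsilon> u) * exp (- sqnorm d u / 2) \<partial>?L)
        = (\<integral>u. f (vaff d x \<epsilon> u) * (?\<kappa> * exp (- sqnorm d u / 2)) \<partial>?L)"
      by (simp only: integral_mult_right_zero[symmetric] mult.left_commute)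
    finally show "?\<kappa>\<^sup>2 * (\<integral>y. ?K (x, y) \<partial>?L)
        = f x * (\<integral>u. f (vaff d x \<epsilon> u) * (?\<kappa> * exp (- sqnorm d u / 2)) \<partial>?L)" .
  qed
  finally show ?thesis .
qed

text \<open>The left-hand sides are Gaussian averages of the autocorrelation of \<open>f\<close>, which concentrate at \<open>0\<close>.\<close>

lemma gaussian_mean_tendsto:
  "(\<lambda>n. \<integral>x. f x * (\<integral>u. f (vaff d x (1 / real (Suc n)) u) * (ft_const d * exp (- sqnorm d u / 2)) \<partial>lborel_Rd d) \<partial>lborel_Rd d)
     \<longlonglongrightarrow> (\<integral>x. (f x)\<^sup>2 \<partial>lborel_Rd d)"
proof -
  let ?L = "lborel_Rd d"
  define \<gamma> where "\<gamma> u = ft_const d * exp (- sqnorm d u / 2)" for u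
  have [measurable]: "\<gamma> \<in> borel_measurable ?L" unfolding \<gamma>_def by measurable
  have \<gamma>0: "0 \<le> \<gamma> u" for u using ft_const_pos[of d] by (simp add: \<gamma>_def)
  have int\<gamma>: "integrable ?L \<gamma>"
    unfolding \<gamma>_def using gaussian_integral_Rd(1)[of 1 d "\<lambda>_. 0"] by simp
  have "(\<integral>u. \<gamma> u \<partial>?L) = ft_const d * (\<integral>u. exp (- sqnorm d u / 2) \<partial>?L)"
    unfolding \<gamma>_def by (rule integral_mult_right_zero)
  then have int\<gamma>1: "(\<integral>u. \<gamma> u \<partial>?L) = 1"
    using gaussian_integral_Rd(2)[of 1 d "\<lambda>_. 0"] by (simp add: ft_const_sqrt)
  let ?G = "\<lambda>n x. \<integral>u. f (vaff d x (1 / real (Suc n)) u) * \<gamma> u \<partial>?L"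
  have vm [measurable]: "(\<lambda>u. f (vaff d x s u)) \<in> borel_measurable ?L" for x s
    by measurable
  have dom: "\<bar>f (vaff d x s u) * \<gamma> u\<bar> \<le> M * \<gamma> u" for x s u
    using bound \<gamma>0 by (simp add: abs_mult mult_right_mono)
  have inner: "(\<lambda>n. ?G n x) \<longlonglongrightarrow> f x" for x
  proof -
    have "(\<lambda>n. ?G n x) \<longlonglongrightarrow> (\<integral>u. f x * \<gamma> u \<partial>?L)"
    proof (rule integral_dominated_convergence[where w="\<lambda>u. M * \<gamma> u"])
      show "AE u in ?L. (\<lambda>n. f (vaff d x (1 / real (Suc n)) u) * \<gamma> u) \<longlonglongrightarrow> f x * \<gamma> u"
      proof (intro AE_I2 tendsto_mult tendsto_const cont)
        fix u i assume "i < d"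
        have "(\<lambda>n. x i + 1 / real (Suc n) * u i) \<longlonglongrightarrow> x i + 0 * u i"
          by (intro tendsto_intros LIMSEQ_Suc[OF lim_1_over_n, unfolded o_def])
        then show "(\<lambda>n. vaff d x (1 / real (Suc n)) u i) \<longlonglongrightarrow> x i"
          using \<open>i < d\<close> by simp
      qed
      show "integrable ?L (\<lambda>u. M * \<gamma> u)" using int\<gamma> by simp
      show "AE u in ?L. norm (f (vaff d x (1 / real (Suc n)) u) * \<gamma> u) \<le> M * \<gamma> u" for n
        using dom by simp
    qed simp_all
    then show ?thesis by (simp add: int\<gamma>1)
  qed
  \<comment> \<open>\<open>?G n x\<close> averages values of \<open>f\<close>, so it is bounded by
    \<open>M\<close> uniformly in \<open>n\<close> and \<open>x\<close>. This supplies the majorant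
    M |f| for the outer limit.\<close>
  have Gle: "\<bar>?G n x\<bar> \<le> M" for n x
  proof -
    have "norm (?G n x) \<le> (\<integral>u. norm (f (vaff d x (1 / real (Suc n)) u) * \<gamma> u) \<partial>?L)"
      by (rule integral_norm_bound)
    also have "\<dots> \<le> (\<integral>u. M * \<gamma> u \<partial>?L)"
      by (rule integral_mono') (use int\<gamma> dom \<gamma>0 M_nonneg in simp_all)
    finally have "norm (?G n x) \<le> (\<integral>u. M * \<gamma> u \<partial>?L)" .
    then show ?thesis by (simp add: int\<gamma>1)
  qed
  have "(\<lambda>n. \<integral>x. f x * ?G n x \<partial>?L) \<longlonglongrightarrow> (\<integral>x. f x * f x \<partial>?L)"
  proof (rule integral_dominated_convergence[where w="\<lambda>x. M * \<bar>f x\<bar>"])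
    show "AE x in ?L. (\<lambda>n. f x * ?G n x) \<longlonglongrightarrow> f x * f x"
      by (intro AE_I2 tendsto_mult tendsto_const inner)
    show "integrable ?L (\<lambda>x. M * \<bar>f x\<bar>)" using integrable by simp
    show "AE x in ?L. norm (f x * ?G n x) \<le> M * \<bar>f x\<bar>" for n
    proof (intro AE_I2)
      fix x
      show "norm (f x * ?G n x) \<le> M * \<bar>f x\<bar>"
        using mult_left_mono[OF Gle[where n=n and x=x], of "\<bar>f x\<bar>"] by (simp add: abs_mult mult.commute)
    qed
    show "(\<lambda>x. f x * ?G n x) \<in> borel_measurable ?L" for n by measurable
  qed simp
  then show ?thesis
    by (simp add: \<gamma>_def power2_eq_square)
qed

text \<open>The weights increase to 1 as \<epsilon> = 1/(n+1) decreases, so monotone convergence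
  removes them. Stated with nonnegative integrals, the identity also yields the square integrability
  of the transform.\<close>

theorem plancherel:
  "(\<integral>\<^sup>+t. ennreal ((cmod (fourier d f t))\<^sup>2) \<partial>lborel_Rd d) = (\<integral>\<^sup>+x. ennreal ((f x)\<^sup>2) \<partial>lborel_Rd d)"
proof -
  let ?L = "lborel_Rd d"
  let ?H = "\<lambda>t. (cmod (fourier d f t))\<^sup>2"
  let ?E = "\<lambda>n t. exp (- (1 / real (Suc n))\<^sup>2 * sqnorm d t / 2)"
  have [measurable]: "?H \<in> borel_measurable ?L"
    unfolding cmod_fourier_square[OF integrable] by measurable
  \<comment> \<open>A crude constant bound, whose purpose is to make each Gaussian-weighted integral
    finite.\<close>
  have Hle: "?H t \<le> (ft_const d)\<^sup>2 * (\<integral>w. \<bar>f (fst w) * f (snd w)\<bar> \<partial>(?L \<Otimes>\<^sub>M ?L))" (is "_ \<le> ?B") for t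
  proof -
    interpret W: pair_sigma_finite ?L ?L by (rule pair_sigma_finite_lborel_Rd)
    have int: "integrable (?L \<Otimes>\<^sub>M ?L) (\<lambda>w. f (fst w) * f (snd w))"
      using W.integrable_tensor[OF integrable integrable] by (simp add: case_prod_unfold)
    have "(\<integral>w. f (fst w) * f (snd w) * cos (dot d (fst w) t - dot d (snd w) t) \<partial>(?L \<Otimes>\<^sub>M ?L))
        \<le> (\<integral>w. \<bar>f (fst w) * f (snd w)\<bar> \<partial>(?L \<Otimes>\<^sub>M ?L))"
    proof (rule integral_mono')
      show "integrable (?L \<Otimes>\<^sub>M ?L) (\<lambda>w. \<bar>f (fst w) * f (snd w)\<bar>)"
        by (rule integrable_abs[OF int])
      show "a * cos \<theta> \<le> \<bar>a\<bar>" for a \<theta> :: real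
        using abs_ge_self[of "a * cos \<theta>"] mult_left_le[of "\<bar>cos \<theta>\<bar>" "\<bar>a\<bar>"] by (simp add: abs_mult)
    qed simp
    then show ?thesis
      unfolding cmod_fourier_square_double by (intro mult_left_mono) auto
  qed
  have int: "integrable ?L (\<lambda>t. ?E n t * ?H t)" for n
  proof (rule Bochner_Integration.integrable_bound)
    show "integrable ?L (\<lambda>t. ?E n t * ?B)"
      using gaussian_integral_Rd(1)[of "1 / real (Suc n)" d "\<lambda>_. 0"] by simp
    show "AE t in ?L. norm (?E n t * ?H t) \<le> norm (?E n t * ?B)"
    proof (rule AE_I2)
      fix t
      show "norm (?E n t * ?H t) \<le> norm (?E n t * ?B)"
      proof -
        have "\<bar>?H t\<bar> \<le> \<bar>?B\<bar>"
          using Hle[of t] zero_le_power2[of "cmod (fourier d f t)"] by linarith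
        then show ?thesis
          unfolding real_norm_def abs_mult[of "?E n t"] by (intro mult_left_mono) simp_all
      qed
    qed
  qed measurable
  have lim: "(\<lambda>n. \<integral>\<^sup>+t. ennreal (?E n t * ?H t) \<partial>?L) \<longlonglongrightarrow> (\<integral>\<^sup>+t. ennreal (?H t) \<partial>?L)"
  proof (rule nn_integral_LIMSEQ)
    show "incseq (\<lambda>n t. ennreal (?E n t * ?H t))"
    proof (intro incseq_SucI le_funI ennreal_leI mult_right_mono)
      fix n t
      have "(1 / real (Suc (Suc n)))\<^sup>2 \<le> (1 / real (Suc n))\<^sup>2"
        by (intro power_mono divide_left_mono) auto
      then show "?E n t \<le> ?E (Suc n) t"
        using mult_right_mono[OF _ sqnorm_nonneg[of t d]] by simp
    qed simp
    fix t
    have "(\<lambda>n. ?E n t * ?H t) \<longlonglongrightarrow> exp (- (0\<^sup>2) * sqnorm d t / 2) * ?H t"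
      by (intro tendsto_intros LIMSEQ_Suc[OF lim_1_over_n, unfolded o_def]) simp
    then show "(\<lambda>n. ennreal (?E n t * ?H t)) \<longlonglongrightarrow> ennreal (?H t)"
      by (intro tendsto_ennrealI) simp
  qed measurable
  have "(\<integral>\<^sup>+t. ennreal (?E n t * ?H t) \<partial>?L) = ennreal (\<integral>t. ?E n t * ?H t \<partial>?L)" for n
    by (rule nn_integral_eq_integral[OF int]) simp
  moreover have "(\<lambda>n. ennreal (\<integral>t. ?E n t * ?H t \<partial>?L)) \<longlonglongrightarrow> ennreal (\<integral>x. (f x)\<^sup>2 \<partial>?L)"
    by (intro tendsto_ennrealI, subst gaussian_mean_fourier) (use gaussian_mean_tendsto in simp_all)
  ultimately have "(\<integral>\<^sup>+t. ennreal (?H t) \<partial>?L) = ennreal (\<integral>x. (f x)\<^sup>2 \<partial>?L)"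
    using lim by (simp add: LIMSEQ_unique)
  also have "\<dots> = (\<integral>\<^sup>+x. ennreal ((f x)\<^sup>2) \<partial>?L)"
    by (rule nn_integral_eq_integral[OF integrable_square, symmetric]) simp
  finally show ?thesis .
qed

end

section \<open>Derivatives of the transformed bump\<close>

lemma C_const_nonneg: "0 \<le> C_const d"
  using C_const_pos[of d] by simp

lemma b_fun_eq: "b_fun d x = sqrt (C_const d) * max 0 (1 - sqnorm d x)"
  by (simp add: b_fun_def bump_eq)

lemma b_fun_nonneg: "0 \<le> b_fun d x"
  by (simp add: b_fun_eq C_const_nonneg)

lemma b_fun_le: "b_fun d x \<le> sqrt (C_const d)"
  unfolding b_fun_eq using sqnorm_nonneg[of x d] by (intro mult_left_le) (auto simp: C_const_nonneg)

lemma b_fun_nz: "b_fun d x \<noteq> 0 \<Longrightarrow> sqnorm d x \<le> 1"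
  by (auto simp: b_fun_eq max_def split: if_splits)

lemma b_fun_measurable [measurable (raw)]:
  "x \<in> M \<rightarrow>\<^sub>M lborel_Rd d \<Longrightarrow> (\<lambda>w. b_fun d (x w)) \<in> borel_measurable M"
  unfolding b_fun_def by (rule bump_measurable)

lemma b_fun_tendsto:
  assumes "\<And>i. i < d \<Longrightarrow> (\<lambda>n. X n i) \<longlonglongrightarrow> x i"
  shows "(\<lambda>n. b_fun d (X n)) \<longlonglongrightarrow> b_fun d x"
  unfolding b_fun_eq by (intro tendsto_intros tendsto_max tendsto_sum) (use assms in auto)

text \<open>The monomial x^\<alpha> times \<open>b\<close>. The multi-index is a multiset of
  directions: one more derivative is \<open>add_mset\<close>, and the order of differentiation
  disappears.\<close>

definition mono_b :: "nat \<Rightarrow> nat multiset \<Rightarrow> (nat \<Rightarrow> real) \<Rightarrow> real" where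
  "mono_b d \<alpha> x = (\<Prod>i\<in>#\<alpha>. x i) * b_fun d x"

lemma mono_b_empty: "mono_b d {#} = b_fun d"
  by (simp add: mono_b_def fun_eq_iff)

lemma mono_b_add: "mono_b d (add_mset i \<alpha>) x = x i * mono_b d \<alpha> x"
  by (simp add: mono_b_def)

lemma mono_b_le:
  assumes "set_mset \<alpha> \<subseteq> {..<d}"
  shows "\<bar>mono_b d \<alpha> x\<bar> \<le> b_fun d x"
  using assms
proof (induction \<alpha>)
  case (add i \<alpha>)
  show ?case
  proof (cases "b_fun d x = 0")
    case False
    then have "\<bar>x i\<bar> \<le> 1"
      using abs_coord_le[of i d x 1] b_fun_nz[of d x] add.prems by simp
    with add show ?thesis
      using mult_mono[of "\<bar>x i\<bar>" 1 "\<bar>mono_b d \<alpha> x\<bar>" "b_fun d x"] by (simp add: mono_b_add abs_mult)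
  qed (simp add: mono_b_def)
qed (simp add: mono_b_def b_fun_nonneg)

lemma test_function_mono_b:
  assumes \<alpha>: "set_mset \<alpha> \<subseteq> {..<d}"
  shows "test_function d (mono_b d \<alpha>) (sqrt (C_const d)) 1"
proof
  show "mono_b d \<alpha> \<in> borel_measurable (lborel_Rd d)"
    using \<alpha>
  proof (induction \<alpha>)
    case (add i \<alpha>)
    then have "i < d" and [measurable]: "mono_b d \<alpha> \<in> borel_measurable (lborel_Rd d)" by auto
    have [measurable]: "(\<lambda>x. x i) \<in> borel_measurable (lborel_Rd d)"
      by (rule component_measurable_lborel_Rd[where d=d]) (use \<open>i < d\<close> in simp_all)
    have "(\<lambda>x. x i * mono_b d \<alpha> x) \<in> borel_measurable (lborel_Rd d)"
      by measurable
    then show ?case by (simp add: mono_b_add[abs_def])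
  qed (simp add: mono_b_empty)
  show "\<bar>mono_b d \<alpha> x\<bar> \<le> sqrt (C_const d)" for x
    using mono_b_le[OF \<alpha>, of x] b_fun_le[of d x] by linarith
  show "mono_b d \<alpha> x = 0" if "x \<in> Rd d" "x \<notin> cball_Rd d 1" for x
  proof -
    have "\<not> sqnorm d x \<le> 1" using that by (simp add: cball_Rd_def)
    then have "b_fun d x = 0" using b_fun_nz by blast
    then show ?thesis by (simp add: mono_b_def)
  qed
  show "(\<lambda>n. mono_b d \<alpha> (X n)) \<longlonglongrightarrow> mono_b d \<alpha> x"
    if lim: "\<And>i. i < d \<Longrightarrow> (\<lambda>n. X n i) \<longlonglongrightarrow> x i" for X x
    using \<alpha>
  proof (induction \<alpha>)
    case (add i \<alpha>)
    then show ?case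
      unfolding mono_b_add by (intro tendsto_mult lim) auto
  qed (simp add: mono_b_empty b_fun_tendsto lim)
qed

lemma integrable_mono_b:
  "set_mset \<alpha> \<subseteq> {..<d} \<Longrightarrow> integrable (lborel_Rd d) (mono_b d \<alpha>)"
  using test_function.integrable[OF test_function_mono_b] .

text \<open>The derivative of the Fourier transform of \<open>b\<close> in the directions \<open>\<alpha>\<close>: each one
  multiplies by \<open>x\<^sub>i\<close> and advances the phase by a quarter period.\<close>

definition bhat :: "nat \<Rightarrow> nat multiset \<Rightarrow> (nat \<Rightarrow> real) \<Rightarrow> real" where
  "bhat d \<alpha> t = ft_const d * cos_int d (mono_b d \<alpha>) (real (size \<alpha>) * (pi / 2)) t"

lemma bhat_measurable [measurable (raw)]:
  assumes "set_mset \<alpha> \<subseteq> {..<d}" and [measurable]: "t \<in> M \<rightarrow>\<^sub>M lborel_Rd d"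
  shows "(\<lambda>w. bhat d \<alpha> (t w)) \<in> borel_measurable M"
proof -
  have [measurable]: "mono_b d \<alpha> \<in> borel_measurable (lborel_Rd d)"
    using test_function.meas[OF test_function_mono_b] assms by blast
  show ?thesis unfolding bhat_def by measurable
qed

lemma bhat_L2:
  assumes "set_mset \<alpha> \<subseteq> {..<d}"
  shows "(\<integral>\<^sup>+t. ennreal ((bhat d \<alpha> t)\<^sup>2) \<partial>lborel_Rd d) \<le> 1"
proof -
  have "(\<integral>\<^sup>+t. ennreal ((bhat d \<alpha> t)\<^sup>2) \<partial>lborel_Rd d)
      \<le> (\<integral>\<^sup>+t. ennreal ((cmod (fourier d (mono_b d \<alpha>) t))\<^sup>2) \<partial>lborel_Rd d)"
    unfolding bhat_def by (intro nn_integral_mono ennreal_leI cos_int_le_fourier integrable_mono_b assms)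
  also have "\<dots> = (\<integral>\<^sup>+x. ennreal ((mono_b d \<alpha> x)\<^sup>2) \<partial>lborel_Rd d)"
    by (rule test_function.plancherel[OF test_function_mono_b[OF assms]])
  also have "\<dots> \<le> (\<integral>\<^sup>+x. ennreal ((b_fun d x)\<^sup>2) \<partial>lborel_Rd d)"
  proof (intro nn_integral_mono ennreal_leI)
    fix x
    show "(mono_b d \<alpha> x)\<^sup>2 \<le> (b_fun d x)\<^sup>2"
      using power_mono[OF mono_b_le[OF assms, of x], of 2] by simp
  qed
  also have "\<dots> = 1" by (rule nn_integral_b_fun_square)
  finally show ?thesis .
qed

text \<open>Differentiation under the integral sign proceeds by explicit quadratic remainders. Here
  cos (\<theta> + \<pi>/2) = - sin \<theta> is the derivative of the cosine, and cos (\<theta> + v)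
  + v sin \<theta> has slope at most |u| for |v| \<le> |u|.\<close>

lemma cos_taylor: "\<bar>cos (\<theta> + u) - cos \<theta> - u * cos (\<theta> + pi / 2)\<bar> \<le> u\<^sup>2" for \<theta> u :: real
proof -
  have sin_lip: "\<bar>sin a - sin b\<bar> \<le> \<bar>a - b\<bar>" for a b :: real
  proof -
    have "\<bar>sin a - sin b\<bar> = 2 * \<bar>sin ((a - b) / 2)\<bar> * \<bar>cos ((a + b) / 2)\<bar>"
      by (simp add: sin_diff_sin abs_mult)
    also have "\<dots> \<le> 2 * \<bar>(a - b) / 2\<bar> * 1"
      by (intro mult_mono abs_sin_x_le_abs_x) auto
    finally show ?thesis by simp
  qed
  let ?f = "\<lambda>v. cos (\<theta> + v) + v * sin \<theta>"
  have "\<bar>?f u - ?f 0\<bar> \<le> \<bar>u\<bar> * \<bar>u - 0\<bar>"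
  proof (rule field_differentiable_bound[where S="{-\<bar>u\<bar>..\<bar>u\<bar>}" and f'="\<lambda>v. sin \<theta> - sin (\<theta> + v)", unfolded real_norm_def])
    fix v assume "v \<in> {-\<bar>u\<bar>..\<bar>u\<bar>}"
    show "(?f has_field_derivative sin \<theta> - sin (\<theta> + v)) (at v within {-\<bar>u\<bar>..\<bar>u\<bar>})"
      by (auto intro!: derivative_eq_intros)
    show "\<bar>sin \<theta> - sin (\<theta> + v)\<bar> \<le> \<bar>u\<bar>"
      using sin_lip[of \<theta> "\<theta> + v"] \<open>v \<in> {-\<bar>u\<bar>..\<bar>u\<bar>}\<close> by auto
  qed auto
  then show ?thesis
    by (simp add: cos_add power2_eq_square algebra_simps flip: abs_mult)
qed

text \<open>The criterion by which both the transform and the mollification are differentiated: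
  unlike limits, quadratic remainder bounds survive integration directly.\<close>

lemma has_real_derivative_quadratic:
  fixes f :: "real \<Rightarrow> real"
  assumes "\<And>h. \<bar>f (x + h) - f x - h * D\<bar> \<le> K * h\<^sup>2"
  shows "(f has_real_derivative D) (at x)"
  unfolding DERIV_def
proof (rule LIM_zero_cancel, rule Lim_null_comparison)
  show "\<forall>\<^sub>F h in at 0. norm ((f (x + h) - f x) / h - D) \<le> K * \<bar>h\<bar>"
  proof (rule eventually_at_ball'[of 1, THEN eventually_mono])
    fix h :: real assume "h \<in> ball 0 1 \<and> h \<noteq> 0 \<and> h \<in> UNIV"
    then have h: "0 < \<bar>h\<bar>" by simp
    have "norm ((f (x + h) - f x) / h - D) = \<bar>f (x + h) - f x - h * D\<bar> / \<bar>h\<bar>"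
      using h by (simp add: field_simps flip: abs_divide)
    also have "\<dots> \<le> K * h\<^sup>2 / \<bar>h\<bar>"
      by (intro divide_right_mono assms) simp
    also have "\<dots> = K * \<bar>h\<bar>"
      using h by (simp add: abs_if power2_eq_square)
    finally show "norm ((f (x + h) - f x) / h - D) \<le> K * \<bar>h\<bar>" .
  qed simp
  have "((\<lambda>h. K * \<bar>h\<bar>) \<longlongrightarrow> K * \<bar>0\<bar>) (at 0)"
    by (intro tendsto_intros)
  then show "((\<lambda>h. K * \<bar>h\<bar>) \<longlongrightarrow> 0) (at 0)" by simp
qed

text \<open>Taking the increment rather than the new value makes shifts compose additively and act
  as translations, which preserve Lebesgue measure.\<close>

definition shift :: "nat \<Rightarrow> real \<Rightarrow> (nat \<Rightarrow> real) \<Rightarrow> nat \<Rightarrow> real" where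
  "shift i h t = t(i := t i + h)"

lemma shift_0 [simp]: "shift i 0 t = t"
  by (simp add: shift_def)

lemma shift_shift [simp]: "shift i h (shift i s t) = shift i (s + h) t"
  by (simp add: shift_def add.assoc)

lemma dot_shift: "i < d \<Longrightarrow> dot d x (shift i h t) = dot d x t + h * x i"
proof -
  assume i: "i < d"
  have "dot d x (shift i h t) = (\<Sum>j<d. x j * t j + (if j = i then h * x i else 0))"
    by (intro sum.cong) (auto simp: shift_def algebra_simps)
  also have "\<dots> = dot d x t + h * x i"
    using i by (simp add: sum.distrib)
  finally show ?thesis .
qed

text \<open>Integrate \<open>cos_taylor\<close> with increment h x_i against x^\<alpha> b. On the
  support of \<open>b\<close> one has |x_i| \<le> 1, so the remainder is at most h^2 times the
  modulus of that function.\<close>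

lemma bhat_taylor:
  assumes \<alpha>: "set_mset \<alpha> \<subseteq> {..<d}" and i: "i < d"
  shows "\<bar>bhat d \<alpha> (shift i h t) - bhat d \<alpha> t - h * bhat d (add_mset i \<alpha>) t\<bar>
    \<le> (ft_const d * (\<integral>x. \<bar>mono_b d \<alpha> x\<bar> \<partial>lborel_Rd d)) * h\<^sup>2"
proof -
  let ?L = "lborel_Rd d" and ?f = "mono_b d \<alpha>"
  let ?\<theta> = "\<lambda>x. dot d x t + real (size \<alpha>) * (pi / 2)"
  have i\<alpha>: "set_mset (add_mset i \<alpha>) \<subseteq> {..<d}" using \<alpha> i by simp
  have 1: "cos_int d ?f (real (size \<alpha>) * (pi / 2)) (shift i h t) = (\<integral>x. ?f x * cos (?\<theta> x + h * x i) \<partial>?L)"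
    unfolding cos_int_def dot_shift[OF i] by (intro Bochner_Integration.integral_cong) (simp_all add: algebra_simps)
  have int1: "integrable ?L (\<lambda>x. ?f x * cos (?\<theta> x + h * x i))"
    using integrable_mult_cos[OF integrable_mono_b[OF \<alpha>], of "shift i h t" "real (size \<alpha>) * (pi / 2)"]
    unfolding dot_shift[OF i] by (simp add: algebra_simps)
  have 3: "cos_int d (mono_b d (add_mset i \<alpha>)) (real (size (add_mset i \<alpha>)) * (pi / 2)) t
      = (\<integral>x. x i * ?f x * cos (?\<theta> x + pi / 2) \<partial>?L)"
    unfolding cos_int_def mono_b_add by (intro Bochner_Integration.integral_cong) (simp_all add: algebra_simps add_divide_distrib)
  have int3: "integrable ?L (\<lambda>x. x i * ?f x * cos (?\<theta> x + pi / 2))"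
    using integrable_mult_cos[OF integrable_mono_b[OF i\<alpha>], of t "real (size \<alpha>) * (pi / 2) + pi / 2"]
    unfolding mono_b_add by (simp add: algebra_simps)
  have int2: "integrable ?L (\<lambda>x. ?f x * cos (?\<theta> x))"
    by (rule integrable_mult_cos[OF integrable_mono_b[OF \<alpha>]])
  let ?R = "\<lambda>x. ?f x * cos (?\<theta> x + h * x i) - ?f x * cos (?\<theta> x) - h * (x i * ?f x * cos (?\<theta> x + pi / 2))"
  have intR: "integrable ?L ?R" using int1 int2 int3 by simp
  have R: "bhat d \<alpha> (shift i h t) - bhat d \<alpha> t - h * bhat d (add_mset i \<alpha>) t = ft_const d * (\<integral>x. ?R x \<partial>?L)"
  proof -
    have "(\<integral>x. ?R x \<partial>?L) = (\<integral>x. ?f x * cos (?\<theta> x + h * x i) \<partial>?L) - (\<integral>x. ?f x * cos (?\<theta> x) \<partial>?L)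
        - h * (\<integral>x. x i * ?f x * cos (?\<theta> x + pi / 2) \<partial>?L)"
      using int1 int2 int3 by simp
    moreover have "cos_int d ?f (real (size \<alpha>) * (pi / 2)) t = (\<integral>x. ?f x * cos (?\<theta> x) \<partial>?L)"
      by (simp add: cos_int_def)
    ultimately show ?thesis
      unfolding bhat_def 1 3 by algebra
  qed
  have Rle: "\<bar>?R x\<bar> \<le> h\<^sup>2 * \<bar>?f x\<bar>" for x
  proof (cases "b_fun d x = 0")
    case False
    then have "(x i)\<^sup>2 \<le> 1"
      using abs_coord_le[OF i, of x 1] b_fun_nz[of d x] by (simp add: abs_square_le_1)
    then have h: "(h * x i)\<^sup>2 \<le> h\<^sup>2"
      by (simp add: power_mult_distrib mult_left_le)
    have "?R x = ?f x * (cos (?\<theta> x + h * x i) - cos (?\<theta> x) - (h * x i) * cos (?\<theta> x + pi / 2))"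
      by (simp add: algebra_simps)
    then have "\<bar>?R x\<bar> = \<bar>?f x\<bar> * \<bar>cos (?\<theta> x + h * x i) - cos (?\<theta> x) - (h * x i) * cos (?\<theta> x + pi / 2)\<bar>"
      by (simp only: abs_mult)
    also have "\<dots> \<le> \<bar>?f x\<bar> * (h * x i)\<^sup>2"
      by (intro mult_left_mono cos_taylor) simp
    also have "\<dots> \<le> \<bar>?f x\<bar> * h\<^sup>2"
      by (intro mult_left_mono h) simp
    finally show ?thesis by (simp add: mult.commute)
  qed (simp add: mono_b_def)
  have "\<bar>\<integral>x. ?R x \<partial>?L\<bar> \<le> (\<integral>x. \<bar>?R x\<bar> \<partial>?L)"
    by (rule integral_abs_bound)
  also have "\<dots> \<le> (\<integral>x. h\<^sup>2 * \<bar>?f x\<bar> \<partial>?L)"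
    by (rule integral_mono'[OF _ Rle]) (use integrable_mono_b[OF \<alpha>] in simp_all)
  finally show ?thesis
    unfolding R using ft_const_pos[of d] by (simp add: abs_mult mult.commute mult_left_mono)
qed

lemma bhat_has_derivative:
  assumes "set_mset \<alpha> \<subseteq> {..<d}" and "i < d"
  shows "((\<lambda>s. bhat d \<alpha> (shift i s t)) has_real_derivative bhat d (add_mset i \<alpha>) (shift i s t)) (at s)"
  by (rule has_real_derivative_quadratic)
     (use bhat_taylor[OF assms, where t="shift i s t"] in simp)

lemma b_fun_even: "b_fun d (vaff d (\<lambda>_. 0) (- 1) x) = b_fun d x"
  by (simp add: b_fun_eq)

lemma sin_int_b_fun: "cos_int d (b_fun d) (pi / 2) t = 0"
proof -
  let ?h = "\<lambda>x. b_fun d x * cos (dot d x t + pi / 2)"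
  have [measurable]: "?h \<in> borel_measurable (lborel_Rd d)"
    using integrable_mult_cos[OF integrable_mono_b[of "{#}" d]] by (auto simp: mono_b_empty)
  have "\<bar>- 1\<bar> ^ d *\<^sub>R (\<integral>x. ?h (vaff d (\<lambda>_. 0) (- 1) x) \<partial>lborel_Rd d) = (\<integral>x. ?h x \<partial>lborel_Rd d)"
    by (rule integral_affine_Rd) simp_all
  moreover have "?h (vaff d (\<lambda>_. 0) (- 1) x) = - ?h x" for x
    unfolding b_fun_even by (simp add: cos_add cos_diff sum_negf)
  ultimately show ?thesis by (simp add: cos_int_def)
qed

lemma fourier_b_fun: "fourier d (b_fun d) t = complex_of_real (bhat d {#} t)"
  using fourier_eq[OF integrable_mono_b[of "{#}" d], of t]
  by (simp add: mono_b_empty bhat_def sin_int_b_fun complex_eq_iff)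

lemma B_fun_eq: "B_fun d t = (bhat d {#} t)\<^sup>2"
  by (simp add: B_fun_def fourier_b_fun flip: of_real_power)

lemma nn_integral_B_fun: "(\<integral>\<^sup>+t. ennreal (B_fun d t) \<partial>lborel_Rd d) = 1"
  using test_function.plancherel[OF test_function_mono_b[of "{#}" d]]
  by (simp add: mono_b_empty fourier_b_fun B_fun_eq nn_integral_b_fun_square)

section \<open>Derivatives of the kernel\<close>

lemma shift_eq_restrict:
  assumes "i < d" "x \<in> Rd d"
  shows "shift i h x = (\<lambda>j\<in>{..<d}. x j + (if j = i then h else 0))"
proof
  fix j
  show "shift i h x j = (\<lambda>j\<in>{..<d}. x j + (if j = i then h else 0)) j"
    using assms PiE_arb[of x "{..<d}" "\<lambda>_. UNIV" j] by (cases "j < d") (simp_all add: shift_def)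
qed

text \<open>Joint measurability in the step and the point, for exchanging the integrals over both in
  the L^1 Taylor bound.\<close>

lemma shift_measurable:
  assumes i: "i < d"
  shows "(\<lambda>p. shift i (fst p) (snd p)) \<in> borel \<Otimes>\<^sub>M lborel_Rd d \<rightarrow>\<^sub>M lborel_Rd d"
proof -
  have "(\<lambda>p. \<lambda>j\<in>{..<d}. snd p j + (if j = i then fst p else 0)) \<in> borel \<Otimes>\<^sub>M lborel_Rd d \<rightarrow>\<^sub>M lborel_Rd d"
  proof (rule measurable_restrict)
    fix j assume "j \<in> {..<d}"
    then have [measurable]: "(\<lambda>p. snd p j) \<in> borel_measurable (borel \<Otimes>\<^sub>M lborel_Rd d)"
      by (intro component_measurable_lborel_Rd[where d=d]) auto
    have [measurable]: "(\<lambda>p. if j = i then fst p else 0) \<in> borel_measurable (borel \<Otimes>\<^sub>M lborel_Rd d)"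
      by measurable
    have "(\<lambda>p. snd p j + (if j = i then fst p else 0)) \<in> borel_measurable (borel \<Otimes>\<^sub>M lborel_Rd d)"
      by (rule borel_measurable_add) fact+
    then show "(\<lambda>p. snd p j + (if j = i then fst p else 0)) \<in> borel \<Otimes>\<^sub>M lborel_Rd d \<rightarrow>\<^sub>M lborel"
      by simp
  qed
  also have "?this \<longleftrightarrow> ?thesis"
  proof (rule measurable_cong)
    fix p assume "p \<in> space (borel \<Otimes>\<^sub>M lborel_Rd d :: (real \<times> _) measure)"
    then have "snd p \<in> Rd d" by (auto simp: space_pair_measure space_PiM)
    then show "(\<lambda>j\<in>{..<d}. snd p j + (if j = i then fst p else 0)) = shift i (fst p) (snd p)"
      using i by (simp add: shift_eq_restrict)
  qed
  finally show ?thesis .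
qed

lemma shift_measurable' [measurable]: "i < d \<Longrightarrow> shift i h \<in> lborel_Rd d \<rightarrow>\<^sub>M lborel_Rd d"
  using measurable_compose[OF measurable_Pair1'[of h borel "lborel_Rd d"] shift_measurable[of i d]] by simp

lemma nn_integral_shift:
  assumes [measurable]: "g \<in> borel_measurable (lborel_Rd d)" and i: "i < d"
  shows "(\<integral>\<^sup>+t. g (shift i h t) \<partial>lborel_Rd d) = (\<integral>\<^sup>+t. g t \<partial>lborel_Rd d)"
proof -
  let ?a = "\<lambda>j. if j = i then h else 0"
  have "(\<integral>\<^sup>+t. g (shift i h t) \<partial>lborel_Rd d) = (\<integral>\<^sup>+t. g (vaff d ?a 1 t) \<partial>lborel_Rd d)"
  proof (intro nn_integral_cong arg_cong[of _ _ g])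
    fix t assume "t \<in> space (lborel_Rd d)"
    then have "t \<in> Rd d" by (simp add: space_PiM)
    then show "shift i h t = vaff d ?a 1 t"
      using i by (simp add: shift_eq_restrict vaff_def add.commute)
  qed
  also have "\<dots> = (\<integral>\<^sup>+t. g t \<partial>lborel_Rd d)"
    using nn_integral_affine_Rd[of g d 1 ?a] by simp
  finally show ?thesis .
qed

text \<open>The mean value theorem gives h (\<phi>'(\<xi>) - \<phi>'(0)), and the bracket is an
  integral of \<phi>'' between 0 and \<xi>. The symmetric interval covers both signs of
  \<open>h\<close>, and an integral on the right can be exchanged with an outer one.\<close>

lemma taylor_remainder_le:
  fixes \<phi> \<phi>' \<phi>'' :: "real \<Rightarrow> real"
  assumes d1: "\<And>s. (\<phi> has_real_derivative \<phi>' s) (at s)"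
    and d2: "\<And>s. (\<phi>' has_real_derivative \<phi>'' s) (at s)"
    and cont: "continuous_on UNIV \<phi>''"
  shows "ennreal \<bar>\<phi> h - \<phi> 0 - h * \<phi>' 0\<bar>
    \<le> ennreal \<bar>h\<bar> * (\<integral>\<^sup>+s. ennreal \<bar>\<phi>'' s\<bar> * indicator {-\<bar>h\<bar>..\<bar>h\<bar>} s \<partial>lborel)"
proof -
  let ?I = "\<integral>\<^sup>+s. ennreal \<bar>\<phi>'' s\<bar> * indicator {-\<bar>h\<bar>..\<bar>h\<bar>} s \<partial>lborel"
  have incr: "ennreal \<bar>\<phi>' b - \<phi>' a\<bar> \<le> ?I" if "a \<le> b" "{a..b} \<subseteq> {-\<bar>h\<bar>..\<bar>h\<bar>}" for a b
  proof -
    have c: "continuous_on {a..b} \<phi>''" using cont continuous_on_subset by blast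
    have "(\<integral>x. indicator {a..b} x *\<^sub>R \<phi>'' x \<partial>lborel) = \<phi>' b - \<phi>' a"
      by (rule integral_FTC_atLeastAtMost[OF that(1) _ c])
         (use d2 in \<open>auto simp: has_real_derivative_iff_has_vector_derivative[symmetric] intro: has_field_derivative_at_within\<close>)
    moreover have "integrable lborel (\<lambda>x. indicator {a..b} x *\<^sub>R \<phi>'' x)"
      using borel_integrable_atLeastAtMost'[OF c] by (simp add: set_integrable_def)
    ultimately have "ennreal \<bar>\<phi>' b - \<phi>' a\<bar> \<le> (\<integral>\<^sup>+x. ennreal (norm (indicator {a..b} x *\<^sub>R \<phi>'' x)) \<partial>lborel)"
      using integral_norm_bound_ennreal[of lborel "\<lambda>x. indicator {a..b} x *\<^sub>R \<phi>'' x"] by simp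
    also have "\<dots> \<le> ?I"
      using that(2) by (intro nn_integral_mono) (auto simp: indicator_def)
    finally show ?thesis .
  qed
  obtain \<xi> where \<xi>: "\<bar>\<xi>\<bar> \<le> \<bar>h\<bar>" "\<phi> h - \<phi> 0 = h * \<phi>' \<xi>"
  proof (cases h "0::real" rule: linorder_cases)
    case less
    obtain z where "h < z" "z < 0" "\<phi> 0 - \<phi> h = (0 - h) * \<phi>' z"
      using MVT2[OF less, of \<phi> \<phi>'] d1 by auto
    then show ?thesis using that[of z] by (simp add: algebra_simps)
  next
    case greater
    obtain z where "0 < z" "z < h" "\<phi> h - \<phi> 0 = (h - 0) * \<phi>' z"
      using MVT2[OF greater, of \<phi> \<phi>'] d1 by auto
    then show ?thesis using that[of z] by simp
  qed (use that[of 0] in simp)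
  have "ennreal \<bar>\<phi>' \<xi> - \<phi>' 0\<bar> \<le> ?I"
  proof (cases "0 \<le> \<xi>")
    case True
    then show ?thesis using incr[of 0 \<xi>] \<xi> by auto
  next
    case False
    then show ?thesis using incr[of \<xi> 0] \<xi> by (auto simp: abs_minus_commute)
  qed
  then have "ennreal \<bar>h\<bar> * ennreal \<bar>\<phi>' \<xi> - \<phi>' 0\<bar> \<le> ennreal \<bar>h\<bar> * ?I"
    by (rule mult_left_mono) simp
  then show ?thesis
    unfolding \<xi>(2) by (simp add: ennreal_mult[symmetric] abs_mult[symmetric] right_diff_distrib)
qed

text \<open>
  An \<open>L\<^sup>1\<close> Taylor bound replaces a pointwise decay estimate: it is what allows to differentiate the
  convolution with a merely bounded function, although no integrable majorant of the difference
  quotients is at hand.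
\<close>

lemma L1_taylor:
  fixes q q' q'' :: "(nat \<Rightarrow> real) \<Rightarrow> real"
  assumes i: "i < d"
    and [measurable]: "q'' \<in> borel_measurable (lborel_Rd d)"
    and d1: "\<And>t s. ((\<lambda>s. q (shift i s t)) has_real_derivative q' (shift i s t)) (at s)"
    and d2: "\<And>t s. ((\<lambda>s. q' (shift i s t)) has_real_derivative q'' (shift i s t)) (at s)"
    and cont: "\<And>t. continuous_on UNIV (\<lambda>s. q'' (shift i s t))"
    and K: "(\<integral>\<^sup>+t. ennreal \<bar>q'' t\<bar> \<partial>lborel_Rd d) \<le> ennreal K" and "0 \<le> K"
  shows "(\<integral>\<^sup>+t. ennreal \<bar>q (shift i h t) - q t - h * q' t\<bar> \<partial>lborel_Rd d) \<le> ennreal (2 * K * h\<^sup>2)"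
proof -
  let ?L = "lborel_Rd d"
  have \<open>pair_sigma_finite ?L (lborel :: real measure)\<close>
    by (intro pair_sigma_finite.intro sigma_finite_lborel_Rd lborel.sigma_finite_measure_axioms)
  then interpret S: pair_sigma_finite ?L "lborel :: real measure" .
  let ?g = "\<lambda>t s. ennreal \<bar>q'' (shift i s t)\<bar> * indicator {-\<bar>h\<bar>..\<bar>h\<bar>} s"
  have "(\<lambda>p. (snd p, fst p)) \<in> ?L \<Otimes>\<^sub>M lborel \<rightarrow>\<^sub>M borel \<Otimes>\<^sub>M ?L"
    by measurable
  from measurable_compose[OF this shift_measurable[OF i]]
  have [measurable]: "(\<lambda>p. shift i (snd p) (fst p)) \<in> ?L \<Otimes>\<^sub>M lborel \<rightarrow>\<^sub>M ?L"
    by simp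
  have "(\<integral>\<^sup>+t. ennreal \<bar>q (shift i h t) - q t - h * q' t\<bar> \<partial>?L) \<le> (\<integral>\<^sup>+t. ennreal \<bar>h\<bar> * (\<integral>\<^sup>+s. ?g t s \<partial>lborel) \<partial>?L)"
  proof (rule nn_integral_mono)
    fix t
    show "ennreal \<bar>q (shift i h t) - q t - h * q' t\<bar> \<le> ennreal \<bar>h\<bar> * (\<integral>\<^sup>+s. ?g t s \<partial>lborel)"
      using taylor_remainder_le[OF d1[of t] d2[of t] cont[of t], of h] by simp
  qed
  also have "\<dots> = ennreal \<bar>h\<bar> * (\<integral>\<^sup>+t. (\<integral>\<^sup>+s. ?g t s \<partial>lborel) \<partial>?L)"
    by (rule nn_integral_cmult, rule lborel.borel_measurable_nn_integral) (simp add: case_prod_unfold)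
  \<comment> \<open>After the exchange, translation invariance makes the inner integral independent
    of \<open>s\<close>. What remains of \<open>s\<close> is the length 2 |h|, and the outer factor
    |h| completes the square.\<close>
  also have "(\<integral>\<^sup>+t. (\<integral>\<^sup>+s. ?g t s \<partial>lborel) \<partial>?L) = (\<integral>\<^sup>+s. (\<integral>\<^sup>+t. ?g t s \<partial>?L) \<partial>lborel)"
    by (rule S.Fubini'[symmetric]) (simp add: case_prod_unfold)
  also have "\<dots> = (\<integral>\<^sup>+s. (\<integral>\<^sup>+t. ennreal \<bar>q'' t\<bar> \<partial>?L) * indicator {-\<bar>h\<bar>..\<bar>h\<bar>} s \<partial>lborel)"
  proof (intro nn_integral_cong)
    fix s
    have "(\<integral>\<^sup>+t. ?g t s \<partial>?L) = (\<integral>\<^sup>+t. ennreal \<bar>q'' (shift i s t)\<bar> \<partial>?L) * indicator {-\<bar>h\<bar>..\<bar>h\<bar>} s"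
      by (rule nn_integral_multc) (use i in measurable)
    also have "(\<integral>\<^sup>+t. ennreal \<bar>q'' (shift i s t)\<bar> \<partial>?L) = (\<integral>\<^sup>+t. ennreal \<bar>q'' t\<bar> \<partial>?L)"
      by (rule nn_integral_shift[OF _ i]) measurable
    finally show "(\<integral>\<^sup>+t. ?g t s \<partial>?L) = (\<integral>\<^sup>+t. ennreal \<bar>q'' t\<bar> \<partial>?L) * indicator {-\<bar>h\<bar>..\<bar>h\<bar>} s" .
  qed
  also have "\<dots> = (\<integral>\<^sup>+t. ennreal \<bar>q'' t\<bar> \<partial>?L) * ennreal (2 * \<bar>h\<bar>)"
    by (simp add: nn_integral_cmult)
  also have "ennreal \<bar>h\<bar> * \<dots> \<le> ennreal \<bar>h\<bar> * (ennreal K * ennreal (2 * \<bar>h\<bar>))"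
    by (intro mult_left_mono mult_right_mono K) simp_all
  also have "\<dots> = ennreal (2 * K * h\<^sup>2)"
    using \<open>0 \<le> K\<close> by (simp add: ennreal_mult[symmetric] power2_eq_square mult_ac)
  finally show ?thesis .
qed

text \<open>The derivative in the directions \<open>is\<close> of \<open>bhat d \<alpha> * bhat d \<beta>\<close>, expanded by the Leibniz rule.\<close>

primrec Bder :: "nat \<Rightarrow> nat list \<Rightarrow> nat multiset \<Rightarrow> nat multiset \<Rightarrow> (nat \<Rightarrow> real) \<Rightarrow> real" where
  "Bder d [] \<alpha> \<beta> t = bhat d \<alpha> t * bhat d \<beta> t"
| "Bder d (i # is) \<alpha> \<beta> t = Bder d is (add_mset i \<alpha>) \<beta> t + Bder d is \<alpha> (add_mset i \<beta>) t"

lemma Bder_measurable [measurable (raw)]: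
  assumes "set is \<subseteq> {..<d}" "set_mset \<alpha> \<subseteq> {..<d}" "set_mset \<beta> \<subseteq> {..<d}" "t \<in> M \<rightarrow>\<^sub>M lborel_Rd d"
  shows "(\<lambda>w. Bder d is \<alpha> \<beta> (t w)) \<in> borel_measurable M"
  using assms by (induction "is" arbitrary: \<alpha> \<beta>) (auto intro!: borel_measurable_times borel_measurable_add bhat_measurable)

text \<open>By induction from the product rule. \<open>Bder\<close> distributes the head of the list
  first, so the step has to interchange \<open>i\<close> and \<open>j\<close>; with multisets both
  orders are the same object.\<close>

lemma Bder_has_derivative:
  assumes "set is \<subseteq> {..<d}" "set_mset \<alpha> \<subseteq> {..<d}" "set_mset \<beta> \<subseteq> {..<d}" "i < d"
  shows "((\<lambda>s. Bder d is \<alpha> \<beta> (shift i s t)) has_real_derivative Bder d (i # is) \<alpha> \<beta> (shift i s t)) (at s)"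
  using assms
proof (induction "is" arbitrary: \<alpha> \<beta>)
  case Nil
  have "((\<lambda>s. bhat d \<alpha> (shift i s t) * bhat d \<beta> (shift i s t)) has_real_derivative
     bhat d (add_mset i \<alpha>) (shift i s t) * bhat d \<beta> (shift i s t)
      + bhat d (add_mset i \<beta>) (shift i s t) * bhat d \<alpha> (shift i s t)) (at s)"
    by (rule DERIV_mult; rule bhat_has_derivative) (use Nil in auto)
  then show ?case by (simp add: mult.commute)
next
  case (Cons j "is")
  have "((\<lambda>s. Bder d is (add_mset j \<alpha>) \<beta> (shift i s t) + Bder d is \<alpha> (add_mset j \<beta>) (shift i s t)) has_real_derivative
     Bder d (i # is) (add_mset j \<alpha>) \<beta> (shift i s t) + Bder d (i # is) \<alpha> (add_mset j \<beta>) (shift i s t)) (at s)"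
    by (rule DERIV_add; rule Cons.IH) (use Cons.prems in auto)
  then show ?case by (simp add: add_mset_commute add_ac)
qed

lemma Bder_L1:
  assumes "set is \<subseteq> {..<d}" "set_mset \<alpha> \<subseteq> {..<d}" "set_mset \<beta> \<subseteq> {..<d}"
  shows "(\<integral>\<^sup>+t. ennreal \<bar>Bder d is \<alpha> \<beta> t\<bar> \<partial>lborel_Rd d) \<le> ennreal (2 ^ length is)"
  using assms
proof (induction "is" arbitrary: \<alpha> \<beta>)
  case Nil
  have [measurable]: "bhat d \<alpha> \<in> borel_measurable (lborel_Rd d)" "bhat d \<beta> \<in> borel_measurable (lborel_Rd d)"
    using bhat_measurable[OF Nil(2) measurable_ident] bhat_measurable[OF Nil(3) measurable_ident] by simp_all
  have "ennreal 2 * (\<integral>\<^sup>+t. ennreal \<bar>Bder d [] \<alpha> \<beta> t\<bar> \<partial>lborel_Rd d)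
      = (\<integral>\<^sup>+t. ennreal (2 * \<bar>bhat d \<alpha> t * bhat d \<beta> t\<bar>) \<partial>lborel_Rd d)"
    by (simp add: ennreal_mult nn_integral_cmult)
  \<comment> \<open>2 |a b| \<le> a^2 + b^2 in place of Cauchy-Schwarz: the bound is the same, since
    both factors have L^2 norm at most 1.\<close>
  also have "\<dots> \<le> (\<integral>\<^sup>+t. ennreal ((bhat d \<alpha> t)\<^sup>2) + ennreal ((bhat d \<beta> t)\<^sup>2) \<partial>lborel_Rd d)"
  proof (intro nn_integral_mono)
    fix t
    show "ennreal (2 * \<bar>bhat d \<alpha> t * bhat d \<beta> t\<bar>) \<le> ennreal ((bhat d \<alpha> t)\<^sup>2) + ennreal ((bhat d \<beta> t)\<^sup>2)"
      using sum_squares_bound[of "\<bar>bhat d \<alpha> t\<bar>" "\<bar>bhat d \<beta> t\<bar>"]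
      by (simp add: ennreal_plus[symmetric] abs_mult mult.assoc del: ennreal_plus)
  qed
  also have "\<dots> = (\<integral>\<^sup>+t. ennreal ((bhat d \<alpha> t)\<^sup>2) \<partial>lborel_Rd d) + (\<integral>\<^sup>+t. ennreal ((bhat d \<beta> t)\<^sup>2) \<partial>lborel_Rd d)"
    by (rule nn_integral_add) simp_all
  also have "\<dots> \<le> 1 + 1"
    by (intro add_mono bhat_L2 Nil)
  finally have "ennreal 2 * (\<integral>\<^sup>+t. ennreal \<bar>Bder d [] \<alpha> \<beta> t\<bar> \<partial>lborel_Rd d) \<le> ennreal 2 * 1"
    by simp
  then show ?case
    by (subst (asm) ennreal_mult_le_mult_iff) simp_all
next
  case (Cons j "is")
  have [measurable]: "Bder d is (add_mset j \<alpha>) \<beta> \<in> borel_measurable (lborel_Rd d)"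
      "Bder d is \<alpha> (add_mset j \<beta>) \<in> borel_measurable (lborel_Rd d)"
    using Bder_measurable[of "is" d "add_mset j \<alpha>" \<beta> "\<lambda>x. x" "lborel_Rd d"]
      Bder_measurable[of "is" d \<alpha> "add_mset j \<beta>" "\<lambda>x. x" "lborel_Rd d"] Cons.prems by simp_all
  have "(\<integral>\<^sup>+t. ennreal \<bar>Bder d (j # is) \<alpha> \<beta> t\<bar> \<partial>lborel_Rd d)
      \<le> (\<integral>\<^sup>+t. ennreal \<bar>Bder d is (add_mset j \<alpha>) \<beta> t\<bar> + ennreal \<bar>Bder d is \<alpha> (add_mset j \<beta>) t\<bar> \<partial>lborel_Rd d)"
    by (intro nn_integral_mono) (simp add: ennreal_plus[symmetric] abs_triangle_ineq del: ennreal_plus)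
  also have "\<dots> = (\<integral>\<^sup>+t. ennreal \<bar>Bder d is (add_mset j \<alpha>) \<beta> t\<bar> \<partial>lborel_Rd d)
      + (\<integral>\<^sup>+t. ennreal \<bar>Bder d is \<alpha> (add_mset j \<beta>) t\<bar> \<partial>lborel_Rd d)"
    by (rule nn_integral_add) simp_all
  also have "\<dots> \<le> ennreal (2 ^ length is) + ennreal (2 ^ length is)"
    by (intro add_mono Cons.IH) (use Cons.prems in auto)
  also have "\<dots> = ennreal (2 ^ length (j # is))"
    by (simp add: ennreal_plus[symmetric] del: ennreal_plus)
  finally show ?case .
qed

text \<open>The remainder is controlled by two further derivatives in direction \<open>i\<close>;
  their L^1 norm accounts for the exponent \<open>length is + 2\<close>.\<close>

lemma Bder_taylor_L1:
  assumes "set is \<subseteq> {..<d}" and i: "i < d"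
  shows "(\<integral>\<^sup>+t. ennreal \<bar>Bder d is {#} {#} (shift i h t) - Bder d is {#} {#} t - h * Bder d (i # is) {#} {#} t\<bar> \<partial>lborel_Rd d)
    \<le> ennreal (2 * 2 ^ (length is + 2) * h\<^sup>2)"
proof (rule L1_taylor[OF i])
  have sub: "set (i # is) \<subseteq> {..<d}" "set (i # i # is) \<subseteq> {..<d}" using assms by auto
  note der = Bder_has_derivative[where \<alpha>="{#}" and \<beta>="{#}", OF _ _ _ i]
  show "Bder d (i # i # is) {#} {#} \<in> borel_measurable (lborel_Rd d)"
    by (rule Bder_measurable[OF sub(2)]) simp_all
  show "((\<lambda>s. Bder d is {#} {#} (shift i s t)) has_real_derivative Bder d (i # is) {#} {#} (shift i s t)) (at s)" for t s
    by (rule der) (use assms in auto)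
  show "((\<lambda>s. Bder d (i # is) {#} {#} (shift i s t)) has_real_derivative Bder d (i # i # is) {#} {#} (shift i s t)) (at s)" for t s
    by (rule der) (use sub in auto)
  show "continuous_on UNIV (\<lambda>s. Bder d (i # i # is) {#} {#} (shift i s t))" for t
    by (rule DERIV_continuous_on[OF has_field_derivative_at_within[OF der]]) (use sub in auto)
  show "(\<integral>\<^sup>+t. ennreal \<bar>Bder d (i # i # is) {#} {#} t\<bar> \<partial>lborel_Rd d) \<le> ennreal (2 ^ (length is + 2))"
    using Bder_L1[OF sub(2), of "{#}" "{#}"] by simp
qed simp

section \<open>Derivatives of the mollification\<close>

text \<open>\<open>F\<close> is Borel and bounded at every point here; the locale is instantiated
  with the clipped Borel representative of a Lebesgue measurable function.\<close>

locale bounded_measurable =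
  fixes d :: nat and F :: "(nat \<Rightarrow> real) \<Rightarrow> real" and M c :: real
  assumes F_meas [measurable]: "F \<in> borel_measurable (lborel_Rd d)"
    and F_bound: "\<And>x. \<bar>F x\<bar> \<le> M"
    and c_pos: "0 < c"
begin

lemma M_nonneg: "0 \<le> M"
  using F_bound[of "\<lambda>_. 0"] by linarith

text \<open>For \<open>a = c x\<close> the kernel is evaluated at c (x - y), so this is the
  L^\<infinity>-L^1 case of Young's inequality. The factor c^d cancels the Jacobian, and the bound
  depends on neither \<open>a\<close> nor \<open>c\<close>.\<close>

lemma convolution:
  assumes [measurable]: "g \<in> borel_measurable (lborel_Rd d)"
    and K: "(\<integral>\<^sup>+t. ennreal \<bar>g t\<bar> \<partial>lborel_Rd d) \<le> ennreal K" and "0 \<le> K"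
  shows integrable_convolution: "integrable (lborel_Rd d) (\<lambda>y. F y * g (vaff d a (- c) y))"
    and convolution_bound: "\<bar>c ^ d * (\<integral>y. F y * g (vaff d a (- c) y) \<partial>lborel_Rd d)\<bar> \<le> M * K"
proof -
  let ?L = "lborel_Rd d" and ?h = "\<lambda>y. F y * g (vaff d a (- c) y)"
  have gv [measurable]: "(\<lambda>y. g (vaff d a (- c) y)) \<in> borel_measurable ?L" by measurable
  have "ennreal (c ^ d) * (\<integral>\<^sup>+y. ennreal (norm (?h y)) \<partial>?L)
      \<le> ennreal (c ^ d) * (\<integral>\<^sup>+y. ennreal M * ennreal \<bar>g (vaff d a (- c) y)\<bar> \<partial>?L)"
    by (intro mult_left_mono nn_integral_mono)
       (simp_all add: abs_mult ennreal_mult[symmetric] M_nonneg F_bound mult_right_mono)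
  also have "\<dots> = ennreal M * (ennreal (\<bar>- c\<bar> ^ d) * (\<integral>\<^sup>+y. ennreal \<bar>g (vaff d a (- c) y)\<bar> \<partial>?L))"
    using c_pos by (simp add: nn_integral_cmult mult.left_commute)
  also have "\<dots> = ennreal M * (\<integral>\<^sup>+t. ennreal \<bar>g t\<bar> \<partial>?L)"
    by (subst nn_integral_affine_Rd) (use c_pos in simp_all)
  also have "\<dots> \<le> ennreal M * ennreal K"
    by (intro mult_left_mono K) simp
  finally have le: "ennreal (c ^ d) * (\<integral>\<^sup>+y. ennreal (norm (?h y)) \<partial>?L) \<le> ennreal (M * K)"
    using M_nonneg \<open>0 \<le> K\<close> by (simp add: ennreal_mult)
  have "(\<integral>\<^sup>+y. ennreal (norm (?h y)) \<partial>?L) < \<infinity>"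
  proof (rule ccontr)
    assume "\<not> ?thesis"
    then have "(\<integral>\<^sup>+y. ennreal (norm (?h y)) \<partial>?L) = \<infinity>" by (simp add: less_top[symmetric])
    then show False using le c_pos by (simp add: ennreal_mult_top top_unique)
  qed
  then show int: "integrable ?L ?h"
    by (intro integrableI_bounded) simp_all
  have "ennreal \<bar>c ^ d * integral\<^sup>L ?L ?h\<bar> = ennreal (c ^ d) * ennreal (norm (integral\<^sup>L ?L ?h))"
    using c_pos by (simp add: abs_mult ennreal_mult)
  also have "\<dots> \<le> ennreal (c ^ d) * (\<integral>\<^sup>+y. ennreal (norm (?h y)) \<partial>?L)"
    by (intro mult_left_mono integral_norm_bound_ennreal int) simp
  also note le
  finally show "\<bar>c ^ d * integral\<^sup>L ?L ?h\<bar> \<le> M * K"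
    using M_nonneg \<open>0 \<le> K\<close> by simp
qed

text \<open>The candidate for the derivative of the mollification. All derivatives fall on the
  kernel because \<open>F\<close> has none, and each contributes a factor \<open>c\<close> by the
  chain rule.\<close>

definition conv_der :: "nat list \<Rightarrow> (nat \<Rightarrow> real) \<Rightarrow> real" where
  "conv_der is x = c ^ length is *
    (c ^ d * (\<integral>y. F y * Bder d is {#} {#} (vaff d (\<lambda>i. c * x i) (- c) y) \<partial>lborel_Rd d))"

lemma conv_der_bound:
  assumes "set is \<subseteq> {..<d}"
  shows "\<bar>conv_der is x\<bar> \<le> M * (2 * c) ^ length is"
proof -
  have "Bder d is {#} {#} \<in> borel_measurable (lborel_Rd d)"
    by (rule Bder_measurable[OF assms]) simp_all
  from convolution_bound[OF this Bder_L1[OF assms], of "\<lambda>i. c * x i"]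
  have "\<bar>c ^ d * (\<integral>y. F y * Bder d is {#} {#} (vaff d (\<lambda>i. c * x i) (- c) y) \<partial>lborel_Rd d)\<bar> \<le> M * 2 ^ length is"
    by simp
  then have "\<bar>conv_der is x\<bar> \<le> c ^ length is * (M * 2 ^ length is)"
    unfolding conv_der_def abs_mult[of "c ^ length is"] using c_pos by (simp add: mult_left_mono)
  then show ?thesis
    by (simp add: power_mult_distrib mult_ac)
qed

lemma vaff_shift:
  assumes "i < d"
  shows "vaff d (\<lambda>j. c * shift i h x j) (- c) y = shift i (c * h) (vaff d (\<lambda>j. c * x j) (- c) y)"
  using assms by (auto simp: vaff_def shift_def fun_eq_iff algebra_simps)

text \<open>Moving \<open>x\<close> by \<open>h\<close> moves the kernel argument by
  \<open>c * h\<close>. The remainder is therefore the convolution of \<open>F\<close> with the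
  Taylor remainder of the kernel, which is of order (c h)^2 in L^1.\<close>

lemma conv_der_taylor:
  assumes "is": "set is \<subseteq> {..<d}" and i: "i < d"
  shows "\<bar>conv_der is (shift i h x) - conv_der is x - h * conv_der (i # is) x\<bar>
    \<le> (c ^ length is * (M * (2 * 2 ^ (length is + 2) * c\<^sup>2))) * h\<^sup>2"
proof -
  let ?L = "lborel_Rd d" and ?n = "length is"
  let ?v = "vaff d (\<lambda>j. c * x j) (- c)"
  let ?B = "\<lambda>is t. Bder d is {#} {#} t"
  let ?R = "\<lambda>t. ?B is (shift i (c * h) t) - ?B is t - (c * h) * ?B (i # is) t"
  have iis: "set (i # is) \<subseteq> {..<d}" using "is" i by simp
  have m1 [measurable]: "?B is \<in> borel_measurable ?L"
    by (rule Bder_measurable[OF "is"]) simp_all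
  have m2 [measurable]: "?B (i # is) \<in> borel_measurable ?L"
    by (rule Bder_measurable[OF iis]) simp_all
  have [measurable]: "shift i (c * h) \<in> ?L \<rightarrow>\<^sub>M ?L" by (rule shift_measurable'[OF i])
  have R [measurable]: "?R \<in> borel_measurable ?L"
    by (intro borel_measurable_diff borel_measurable_times m1 m2 measurable_compose[OF _ m1]) measurable
  have int1: "integrable ?L (\<lambda>y. F y * ?B is (?v y))"
    by (rule integrable_convolution[OF m1 Bder_L1[OF "is"]]) simp_all
  have int2: "integrable ?L (\<lambda>y. F y * ?B (i # is) (?v y))"
    by (rule integrable_convolution[OF m2 Bder_L1[OF iis]]) simp_all
  have int3: "integrable ?L (\<lambda>y. F y * ?B is (shift i (c * h) (?v y)))"
    using integrable_convolution[OF m1 Bder_L1[OF "is"], of "\<lambda>j. c * shift i h x j"]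
    by (simp add: vaff_shift[OF i])
  \<comment> \<open>\<open>conv_der (i # is)\<close> carries one more factor \<open>c\<close>, which
    joins \<open>h\<close> to form the step \<open>c * h\<close> of the kernel.\<close>
  have alg: "C * (D * I1) - C * (D * I2) - h * (c * C * (D * I3)) = C * (D * I)"
    if "I = I1 - I2 - (c * h) * I3" for C D I I1 I2 I3 :: real
    unfolding that by (simp add: algebra_simps)
  have "(\<integral>y. F y * ?R (?v y) \<partial>?L) = (\<integral>y. F y * ?B is (shift i (c * h) (?v y)) - F y * ?B is (?v y)
      - (c * h) * (F y * ?B (i # is) (?v y)) \<partial>?L)"
    by (simp only: right_diff_distrib mult.left_commute)
  also have "\<dots> = (\<integral>y. F y * ?B is (shift i (c * h) (?v y)) \<partial>?L) - (\<integral>y. F y * ?B is (?v y) \<partial>?L)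
      - (c * h) * (\<integral>y. F y * ?B (i # is) (?v y) \<partial>?L)"
    using int1 int2 int3 by (simp del: Bder.simps)
  finally have eq: "conv_der is (shift i h x) - conv_der is x - h * conv_der (i # is) x
      = c ^ ?n * (c ^ d * (\<integral>y. F y * ?R (?v y) \<partial>?L))"
    unfolding conv_der_def vaff_shift[OF i] length_Cons power_Suc by (rule alg)
  have "(\<integral>\<^sup>+t. ennreal \<bar>?R t\<bar> \<partial>?L) \<le> ennreal (2 * 2 ^ (?n + 2) * (c * h)\<^sup>2)"
    by (rule Bder_taylor_L1[OF "is" i])
  from convolution_bound[OF R this, of "\<lambda>j. c * x j"]
  have "\<bar>c ^ d * (\<integral>y. F y * ?R (?v y) \<partial>?L)\<bar> \<le> M * (2 * 2 ^ (?n + 2) * (c * h)\<^sup>2)"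
    by (simp del: Bder.simps)
  then have "c ^ ?n * \<bar>c ^ d * (\<integral>y. F y * ?R (?v y) \<partial>?L)\<bar> \<le> c ^ ?n * (M * (2 * 2 ^ (?n + 2) * (c * h)\<^sup>2))"
    using c_pos by (intro mult_left_mono) simp_all
  also have "\<dots> = (c ^ ?n * (M * (2 * 2 ^ (?n + 2) * c\<^sup>2))) * h\<^sup>2"
    by (simp add: power_mult_distrib)
  finally have le: "c ^ ?n * \<bar>c ^ d * (\<integral>y. F y * ?R (?v y) \<partial>?L)\<bar>
      \<le> (c ^ ?n * (M * (2 * 2 ^ (?n + 2) * c\<^sup>2))) * h\<^sup>2" .
  have "\<bar>c ^ ?n * X\<bar> = c ^ ?n * \<bar>X\<bar>" for X
    using c_pos by (simp add: abs_mult)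
  then show ?thesis
    unfolding eq by (rule ord_eq_le_trans) (rule le)
qed

lemma conv_der_has_derivative:
  assumes "set is \<subseteq> {..<d}" and "i < d"
  shows "((\<lambda>s. conv_der is (x(i := s))) has_real_derivative conv_der (i # is) x) (at (x i))"
proof (rule has_real_derivative_quadratic)
  fix h
  show "\<bar>conv_der is (x(i := x i + h)) - conv_der is (x(i := x i)) - h * conv_der (i # is) x\<bar>
    \<le> (c ^ length is * (M * (2 * 2 ^ (length is + 2) * c\<^sup>2))) * h\<^sup>2"
    using conv_der_taylor[OF assms, of h x] by (simp add: shift_def)
qed

text \<open>Existence and value are proved together, since the next derivative is taken of the
  previous one as given by \<open>foldr\<close>. Agreement on \<open>Rd d\<close> is enough:
  changing a coordinate below \<open>d\<close> stays in that set.\<close>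

lemma partials_conv_der:
  assumes f: "\<And>x. x \<in> Rd d \<Longrightarrow> f x = conv_der [] x" and "is": "set is \<subseteq> {..<d}"
  shows "has_partials d is f \<and> (\<forall>x\<in>Rd d. foldr partial is f x = conv_der is x)"
  using "is"
proof (induction "is")
  case (Cons i "is")
  then have i: "i < d" and sub: "set is \<subseteq> {..<d}"
    and IH: "has_partials d is f" "\<And>x. x \<in> Rd d \<Longrightarrow> foldr partial is f x = conv_der is x" by auto
  have der: "((\<lambda>s. foldr partial is f (x(i := s))) has_real_derivative conv_der (i # is) x) (at (x i))"
    if "x \<in> Rd d" for x
  proof -
    have "x(i := s) \<in> Rd d" for s
      using that i by (auto simp: PiE_iff extensional_def)
    then show ?thesis
      using conv_der_has_derivative[OF sub i, of x] by (simp add: IH)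
  qed
  show ?case
  proof (intro conjI ballI)
    show "has_partials d (i # is) f"
      using IH(1) der by (auto simp: has_partial_def real_differentiable_def)
    show "foldr partial (i # is) f x = conv_der (i # is) x" if "x \<in> Rd d" for x
      using DERIV_imp_deriv[OF der[OF that]] by (simp add: partial_def)
  qed
qed (use f in simp)

end

section \<open>Second moment of the kernel\<close>

lemma integral_shift:
  fixes g :: "(nat \<Rightarrow> real) \<Rightarrow> real"
  assumes [measurable]: "g \<in> borel_measurable (lborel_Rd d)" and i: "i < d"
  shows "(\<integral>t. g (shift i h t) \<partial>lborel_Rd d) = (\<integral>t. g t \<partial>lborel_Rd d)"
proof -
  let ?a = "\<lambda>j. if j = i then h else 0"
  have "(\<integral>t. g (shift i h t) \<partial>lborel_Rd d) = (\<integral>t. g (vaff d ?a 1 t) \<partial>lborel_Rd d)"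
  proof (intro Bochner_Integration.integral_cong arg_cong[of _ _ g] refl)
    fix t assume "t \<in> space (lborel_Rd d)"
    then have "t \<in> Rd d" by (simp add: space_PiM)
    then show "shift i h t = vaff d ?a 1 t"
      using i by (simp add: shift_eq_restrict vaff_def add.commute)
  qed
  also have "\<dots> = (\<integral>t. g t \<partial>lborel_Rd d)"
    using integral_affine_Rd[of g d 1 ?a] by simp
  finally show ?thesis .
qed

lemma dot_shift_left: "i < d \<Longrightarrow> dot d (shift i h x) t = dot d x t + h * t i"
  using dot_shift[of i d t h x] by (simp add: mult.commute)

lemma sqnorm_shift:
  assumes i: "i < d"
  shows "sqnorm d (shift i h x) = sqnorm d x + (2 * h * x i + h\<^sup>2)"
proof -
  have "sqnorm d (shift i h x) = (\<Sum>j<d. (x j)\<^sup>2 + (if j = i then 2 * h * x i + h\<^sup>2 else 0))"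
    by (intro sum.cong refl) (simp add: shift_def power2_eq_square algebra_simps)
  then show ?thesis
    using i by (simp add: sum.distrib)
qed

text \<open>
  The gradient of \<open>b\<close> jumps at the unit sphere, so the second moment of \<open>B\<close> is computed from the
  continuous difference quotients of \<open>b\<close> and Fatou's lemma.
\<close>

definition b_diff :: "nat \<Rightarrow> nat \<Rightarrow> real \<Rightarrow> (nat \<Rightarrow> real) \<Rightarrow> real" where
  "b_diff d i h x = b_fun d (shift i h x) - b_fun d x"

text \<open>Reverse triangle inequality: if |x| > 1 + h, then the shifted point has norm at least
  |x| - h > 1, and both values of \<open>b\<close> vanish. The argument runs with squares and uses
  x_i \<ge> - |x|.\<close>

lemma b_diff_support:
  assumes i: "i < d" and h: "0 < h" and nz: "b_diff d i h x \<noteq> 0"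
  shows "sqnorm d x \<le> (1 + h)\<^sup>2"
proof (rule ccontr)
  assume neg: "\<not> sqnorm d x \<le> (1 + h)\<^sup>2"
  define s where "s = sqrt (sqnorm d x)"
  have s: "s\<^sup>2 = sqnorm d x" "0 \<le> s" using sqnorm_nonneg[of x d] by (auto simp: s_def)
  have "(1 + h)\<^sup>2 < s\<^sup>2" using neg s by simp
  then have "1 + h < s" using s(2) by (rule power_less_imp_less_base)
  then have "1\<^sup>2 < (s - h)\<^sup>2" by (intro power_strict_mono) auto
  moreover have "- s \<le> x i" using abs_coord_le[OF i, of x s] s by simp
  then have "h * (- s) \<le> h * x i" using h by (intro mult_left_mono) auto
  then have "(s - h)\<^sup>2 \<le> sqnorm d (shift i h x)"
    unfolding sqnorm_shift[OF i] s(1)[symmetric] by (simp add: power2_eq_square algebra_simps)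
  moreover have "(1::real) \<le> (1 + h)\<^sup>2" using h by simp
  ultimately have "\<not> sqnorm d (shift i h x) \<le> 1" "\<not> sqnorm d x \<le> 1" using neg by auto
  then have "b_fun d (shift i h x) = 0" "b_fun d x = 0" using b_fun_nz by blast+
  with nz show False by (simp add: b_diff_def)
qed

text \<open>Truncation at 0 is 1-Lipschitz, so the kink at the sphere costs nothing. The numbers
  come from (2 x_i + h)^2 + (2 x_i - h)^2 = 8 x_i^2 + 2 h^2.\<close>

lemma b_diff_square_le:
  assumes i: "i < d"
  shows "(b_diff d i h x)\<^sup>2 \<le> C_const d * h\<^sup>2 * (8 * (x i)\<^sup>2 + 2 * h\<^sup>2)"
proof -
  let ?m = "\<lambda>x. max 0 (1 - sqnorm d x)"
  have "\<bar>?m (shift i h x) - ?m x\<bar> \<le> \<bar>2 * h * x i + h\<^sup>2\<bar>"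
    unfolding sqnorm_shift[OF i] by linarith
  then have "(?m (shift i h x) - ?m x)\<^sup>2 \<le> (2 * h * x i + h\<^sup>2)\<^sup>2"
    by (simp add: abs_le_square_iff)
  also have "\<dots> = h\<^sup>2 * (2 * x i + h)\<^sup>2"
    by (simp add: power2_eq_square algebra_simps)
  also have "\<dots> \<le> h\<^sup>2 * (8 * (x i)\<^sup>2 + 2 * h\<^sup>2)"
    using zero_le_power2[of "2 * x i - h"] by (intro mult_left_mono) (simp_all add: power2_eq_square algebra_simps)
  finally have "C_const d * (?m (shift i h x) - ?m x)\<^sup>2 \<le> C_const d * (h\<^sup>2 * (8 * (x i)\<^sup>2 + 2 * h\<^sup>2))"
    by (intro mult_left_mono C_const_nonneg)
  moreover have "(b_diff d i h x)\<^sup>2 = C_const d * (?m (shift i h x) - ?m x)\<^sup>2"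
    by (simp add: b_diff_def b_fun_eq right_diff_distrib[symmetric] power_mult_distrib C_const_nonneg del: max.absorb1)
  ultimately show ?thesis by (simp add: mult.assoc)
qed

lemma test_function_b_diff:
  assumes i: "i < d" and h: "0 < h"
  shows "test_function d (b_diff d i h) (2 * sqrt (C_const d)) (1 + h)"
proof
  have [measurable]: "shift i h \<in> lborel_Rd d \<rightarrow>\<^sub>M lborel_Rd d" by (rule shift_measurable'[OF i])
  show "b_diff d i h \<in> borel_measurable (lborel_Rd d)"
    unfolding b_diff_def[abs_def] by measurable
  show "\<bar>b_diff d i h x\<bar> \<le> 2 * sqrt (C_const d)" for x
    using b_fun_le[of d x] b_fun_le[of d "shift i h x"] b_fun_nonneg[of d x] b_fun_nonneg[of d "shift i h x"]
    unfolding b_diff_def by linarith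
  show "b_diff d i h x = 0" if "x \<in> Rd d" "x \<notin> cball_Rd d (1 + h)" for x
  proof -
    have "\<not> sqnorm d x \<le> (1 + h)\<^sup>2" using that by (simp add: cball_Rd_def)
    then show ?thesis using b_diff_support[OF i h] by blast
  qed
  show "(\<lambda>n. b_diff d i h (X n)) \<longlonglongrightarrow> b_diff d i h x"
    if lim: "\<And>i. i < d \<Longrightarrow> (\<lambda>n. X n i) \<longlonglongrightarrow> x i" for X x
    unfolding b_diff_def
  proof (intro tendsto_diff b_fun_tendsto lim)
    fix j assume "j < d"
    then have "(\<lambda>n. X n j + (if j = i then h else 0)) \<longlonglongrightarrow> x j + (if j = i then h else 0)"
      by (intro tendsto_intros lim)
    moreover have "shift i h y j = y j + (if j = i then h else 0)" for y
      by (simp add: shift_def)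
    ultimately show "(\<lambda>n. shift i h (X n) j) \<longlonglongrightarrow> shift i h x j"
      by simp
  qed
qed

text \<open>Translating by \<open>h\<close> along axis \<open>i\<close> multiplies the transform by
  exp (i \<theta>) with \<theta> = h t_i, so the difference acquires the factor exp (i \<theta>) -
  1, of modulus 2 |sin (\<theta>/2)|.\<close>

lemma fourier_b_diff:
  assumes i: "i < d" and h: "0 < h"
  shows "(cmod (fourier d (b_diff d i h) t))\<^sup>2 = (2 * sin (h * t i / 2))\<^sup>2 * B_fun d t"
proof -
  let ?L = "lborel_Rd d" and ?A = "cos_int d (b_fun d) 0 t"
  have intb: "integrable ?L (b_fun d)"
    using integrable_mono_b[of "{#}" d] by (simp add: mono_b_empty)
  have intd: "integrable ?L (b_diff d i h)"
    using test_function.integrable[OF test_function_b_diff[OF i h]] .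
  have b: "cos_int d (b_fun d) \<phi> t = cos \<phi> * ?A" for \<phi>
    using cos_int_shift[OF intb, of \<phi> t] by (simp add: sin_int_b_fun)
  have d: "cos_int d (b_diff d i h) \<phi> t = (cos (\<phi> - h * t i) - cos \<phi>) * ?A" for \<phi>
  proof -
    let ?H = "\<lambda>x. b_fun d x * cos (dot d x t + (\<phi> - h * t i))"
    have intH: "integrable ?L ?H"
      by (rule integrable_mult_cos[OF intb])
    then have [measurable]: "?H \<in> borel_measurable ?L" by auto
    have eq: "?H (shift i h x) = b_fun d (shift i h x) * cos (dot d x t + \<phi>)" for x
      by (simp add: dot_shift_left[OF i])
    have "integrable ?L (\<lambda>x. b_diff d i h x * cos (dot d x t + \<phi>) + b_fun d x * cos (dot d x t + \<phi>))"
      by (intro Bochner_Integration.integrable_add integrable_mult_cos intd intb)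
    then have intS: "integrable ?L (\<lambda>x. ?H (shift i h x))"
      unfolding eq by (simp add: b_diff_def left_diff_distrib)
    have "cos_int d (b_diff d i h) \<phi> t = (\<integral>x. ?H (shift i h x) - b_fun d x * cos (dot d x t + \<phi>) \<partial>?L)"
      unfolding cos_int_def eq by (simp add: b_diff_def left_diff_distrib)
    also have "\<dots> = (\<integral>x. ?H (shift i h x) \<partial>?L) - cos_int d (b_fun d) \<phi> t"
      unfolding cos_int_def by (rule Bochner_Integration.integral_diff[OF intS integrable_mult_cos[OF intb]])
    also have "(\<integral>x. ?H (shift i h x) \<partial>?L) = cos_int d (b_fun d) (\<phi> - h * t i) t"
      unfolding cos_int_def by (rule integral_shift[OF _ i]) simp
    finally show ?thesis
      using b[of \<phi>] b[of "\<phi> - h * t i"] by (simp only: left_diff_distrib)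
  qed
  have "(cos (- \<theta>) - 1)\<^sup>2 + (cos (pi / 2 - \<theta>))\<^sup>2 = (2 * sin (\<theta> / 2))\<^sup>2" for \<theta> :: real
  proof -
    have "(cos \<theta> - 1)\<^sup>2 + (sin \<theta>)\<^sup>2 = 2 - 2 * cos \<theta>"
      by (simp add: power2_diff sin_squared_eq)
    also have "\<dots> = (2 * sin (\<theta> / 2))\<^sup>2"
      using cos_double_sin[of "\<theta> / 2"] by (simp add: power_mult_distrib)
    finally show ?thesis by (simp add: cos_diff)
  qed
  from this[of "h * t i"]
  have "(cos_int d (b_diff d i h) 0 t)\<^sup>2 + (cos_int d (b_diff d i h) (pi / 2) t)\<^sup>2 = (2 * sin (h * t i / 2))\<^sup>2 * ?A\<^sup>2"
    unfolding d power_mult_distrib by (simp add: distrib_right[symmetric])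
  then show ?thesis
    unfolding cmod_fourier_square[OF intd] B_fun_eq bhat_def mono_b_empty
    by (simp add: power_mult_distrib)
qed

lemma B_fun_measurable [measurable]: "B_fun d \<in> borel_measurable (lborel_Rd d)"
proof -
  have "bhat d {#} \<in> borel_measurable (lborel_Rd d)"
    by (rule bhat_measurable) simp_all
  then show ?thesis unfolding B_fun_eq[abs_def] by simp
qed

text \<open>Plancherel converts the left side into squared difference quotients of \<open>b\<close>.
  These live on the ball of radius 1 + h \<le> 3/2 and sum to at most C_d (8 * 9/4 + 2 * 1/4) \<le>
  20 C_d. That ball has at most twice the unit volume, and C_d times the unit volume is at most 8 (d
  + 1)^2; hence 320 = 20 * 2 * 8.\<close>

lemma difference_quotient_moment:
  assumes h: "0 < h" "h \<le> 1 / (2 * (real d + 1))"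
  shows "(\<integral>\<^sup>+t. ennreal ((\<Sum>i<d. (2 * sin (h * t i / 2) / h)\<^sup>2) * B_fun d t) \<partial>lborel_Rd d) \<le> ennreal (320 * (real d + 1)\<^sup>2)"
proof -
  let ?L = "lborel_Rd d" and ?V = "emeasure (lborel_Rd d) (cball_Rd d 1)"
  have hd: "h \<le> 1/2" "real d * h \<le> 1/2"
  proof -
    have *: "h * (2 * (real d + 1)) \<le> 1"
      using h(2) by (simp add: pos_le_divide_eq)
    then show "real d * h \<le> 1/2" using h(1) by (simp add: algebra_simps)
    have "0 \<le> real d * h" using h(1) by simp
    then show "h \<le> 1/2" using * by (simp add: algebra_simps)
  qed
  \<comment> \<open>(1 + h)^d (1 - h)^d \<le> 1, and Bernoulli bounds the second factor below by
    1/2.\<close>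
  have pow: "(1 + h) ^ d \<le> 2"
  proof -
    have "1/2 \<le> (1 - h) ^ d"
      using Bernoulli_inequality[of "-h" d] h hd by (simp add: algebra_simps)
    then have "(1 + h) ^ d * (1/2) \<le> (1 + h) ^ d * (1 - h) ^ d"
      using h by (intro mult_left_mono) auto
    also have "\<dots> = (1 - h\<^sup>2) ^ d"
      by (simp add: power_mult_distrib[symmetric] power2_eq_square algebra_simps)
    also have "\<dots> \<le> 1"
      using h hd by (intro power_le_one) (auto simp: power_le_one abs_square_le_1)
    finally show ?thesis by simp
  qed
  have meas_diff [measurable]: "b_diff d i h \<in> borel_measurable ?L" if "i < d" for i
    using test_function.meas[OF test_function_b_diff[OF that h(1)]] .
  have meas_sin [measurable]: "(\<lambda>t. sin (h * t i / 2)) \<in> borel_measurable ?L" if "i < d" for i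
    using component_measurable_lborel_Rd[of "\<lambda>x. x" ?L d i] that by simp
  have one: "(\<integral>\<^sup>+t. ennreal ((2 * sin (h * t i / 2) / h)\<^sup>2 * B_fun d t) \<partial>?L)
      = (\<integral>\<^sup>+x. ennreal ((b_diff d i h x)\<^sup>2 / h\<^sup>2) \<partial>?L)" if i: "i < d" for i
  proof -
    have "(\<integral>\<^sup>+t. ennreal ((2 * sin (h * t i / 2) / h)\<^sup>2 * B_fun d t) \<partial>?L)
        = (\<integral>\<^sup>+t. ennreal (1 / h\<^sup>2) * ennreal ((cmod (fourier d (b_diff d i h) t))\<^sup>2) \<partial>?L)"
      unfolding fourier_b_diff[OF i h(1)]
      by (intro nn_integral_cong) (simp add: ennreal_mult[symmetric] B_fun_eq power_divide)
    also have "\<dots> = ennreal (1 / h\<^sup>2) * (\<integral>\<^sup>+t. ennreal ((cmod (fourier d (b_diff d i h) t))\<^sup>2) \<partial>?L)"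
      unfolding fourier_b_diff[OF i h(1)] using meas_sin[OF i] by (intro nn_integral_cmult) simp
    also have "\<dots> = ennreal (1 / h\<^sup>2) * (\<integral>\<^sup>+x. ennreal ((b_diff d i h x)\<^sup>2) \<partial>?L)"
      by (simp only: test_function.plancherel[OF test_function_b_diff[OF i h(1)]])
    also have "\<dots> = (\<integral>\<^sup>+x. ennreal (1 / h\<^sup>2) * ennreal ((b_diff d i h x)\<^sup>2) \<partial>?L)"
      using meas_diff[OF i] by (intro nn_integral_cmult[symmetric]) simp
    finally show ?thesis
      by (simp add: ennreal_mult[symmetric])
  qed
  have "(\<integral>\<^sup>+t. ennreal ((\<Sum>i<d. (2 * sin (h * t i / 2) / h)\<^sup>2) * B_fun d t) \<partial>?L)
      = (\<integral>\<^sup>+t. (\<Sum>i<d. ennreal ((2 * sin (h * t i / 2) / h)\<^sup>2 * B_fun d t)) \<partial>?L)"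
    by (intro nn_integral_cong) (simp add: sum_distrib_right B_fun_eq)
  also have "\<dots> = (\<Sum>i<d. \<integral>\<^sup>+t. ennreal ((2 * sin (h * t i / 2) / h)\<^sup>2 * B_fun d t) \<partial>?L)"
    using meas_sin by (intro nn_integral_sum) simp
  also have "\<dots> = (\<Sum>i<d. \<integral>\<^sup>+x. ennreal ((b_diff d i h x)\<^sup>2 / h\<^sup>2) \<partial>?L)"
    by (intro sum.cong refl one) simp
  also have "\<dots> = (\<integral>\<^sup>+x. (\<Sum>i<d. ennreal ((b_diff d i h x)\<^sup>2 / h\<^sup>2)) \<partial>?L)"
    using meas_diff by (intro nn_integral_sum[symmetric]) simp
  also have "\<dots> \<le> (\<integral>\<^sup>+x. ennreal (20 * C_const d) * indicator (cball_Rd d (1 + h)) x \<partial>?L)"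
  proof (rule nn_integral_mono)
    fix x assume x: "x \<in> space ?L"
    show "(\<Sum>i<d. ennreal ((b_diff d i h x)\<^sup>2 / h\<^sup>2)) \<le> ennreal (20 * C_const d) * indicator (cball_Rd d (1 + h)) x"
    proof (cases "sqnorm d x \<le> (1 + h)\<^sup>2")
      case True
      have "(\<Sum>i<d. (b_diff d i h x)\<^sup>2 / h\<^sup>2) \<le> (\<Sum>i<d. C_const d * (8 * (x i)\<^sup>2 + 2 * h\<^sup>2))"
      proof (rule sum_mono)
        fix i assume "i \<in> {..<d}"
        then show "(b_diff d i h x)\<^sup>2 / h\<^sup>2 \<le> C_const d * (8 * (x i)\<^sup>2 + 2 * h\<^sup>2)"
          using b_diff_square_le[of i d h x] h(1) by (simp add: pos_divide_le_eq mult_ac)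
      qed
      also have "\<dots> = C_const d * (8 * sqnorm d x + 2 * (real d * h) * h)"
        by (simp add: sum_distrib_left[symmetric] sum.distrib power2_eq_square)
      also have "\<dots> \<le> C_const d * 20"
      proof (intro mult_left_mono C_const_nonneg)
        have "sqnorm d x \<le> (3/2)\<^sup>2"
          using True power_mono[of "1 + h" "3/2" 2] h hd by linarith
        moreover have "(real d * h) * h \<le> (1/2) * (1/2)"
          using h hd by (intro mult_mono) auto
        ultimately show "8 * sqnorm d x + 2 * (real d * h) * h \<le> 20"
          by (simp add: power2_eq_square)
      qed
      finally have "ennreal (\<Sum>i<d. (b_diff d i h x)\<^sup>2 / h\<^sup>2) \<le> ennreal (20 * C_const d)"
        by (intro ennreal_leI) simp
      moreover have "x \<in> cball_Rd d (1 + h)"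
        using True x by (simp add: cball_Rd_def space_PiM)
      ultimately show ?thesis by simp
    next
      case False
      then have "b_diff d i h x = 0" if "i < d" for i
        using b_diff_support[OF that h(1)] by blast
      then show ?thesis by simp
    qed
  qed
  also have "\<dots> = ennreal (20 * C_const d) * emeasure ?L (cball_Rd d (1 + h))"
    by (simp add: nn_integral_cmult)
  also have "emeasure ?L (cball_Rd d (1 + h)) = ennreal ((1 + h) ^ d) * ?V"
    using h by (intro emeasure_cball_Rd) simp
  also have "ennreal (20 * C_const d) * \<dots> \<le> ennreal (20 * C_const d) * (ennreal 2 * ?V)"
    using pow by (intro mult_left_mono mult_right_mono ennreal_leI) simp_all
  also have "\<dots> = ennreal 40 * (ennreal (C_const d) * ?V)"
  proof -
    have "ennreal (20 * C_const d) * ennreal 2 = ennreal 40 * ennreal (C_const d)"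
      by (subst (1 2) ennreal_mult[symmetric]) (simp_all add: C_const_nonneg)
    then show ?thesis by (simp only: mult.assoc[symmetric])
  qed
  also have "\<dots> \<le> ennreal 40 * ennreal (8 * (real d + 1)\<^sup>2)"
    by (intro mult_left_mono C_const_volume) simp
  also have "\<dots> = ennreal (320 * (real d + 1)\<^sup>2)"
    by (subst ennreal_mult[symmetric]) simp_all
  finally show ?thesis .
qed

text \<open>As \<open>h\<close> tends to 0, 2 sin (h a/2) / h tends to \<open>a\<close>, and the
  bound of the quotients is uniform in \<open>h\<close>. The case \<open>d = 0\<close> is separate
  because (d + 1)^2 is not O(d^2) there; the moment is then an integral of 0.\<close>

lemma second_moment_B:
  "(\<integral>\<^sup>+t. ennreal (sqnorm d t * B_fun d t) \<partial>lborel_Rd d) \<le> ennreal (1280 * (real d)\<^sup>2)"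
proof (cases "d = 0")
  case False
  let ?L = "lborel_Rd d"
  \<comment> \<open>The offset makes every term, not just the late ones, satisfy the smallness
    condition on \<open>h\<close>.\<close>
  define h where "h n = inverse (real (Suc (n + 2 * (d + 1))))" for n
  have h: "0 < h n" "h n \<le> 1 / (2 * (real d + 1))" for n
    unfolding h_def inverse_eq_divide by (auto intro!: divide_left_mono)
  have "h \<longlonglongrightarrow> 0"
    unfolding h_def by (rule LIMSEQ_ignore_initial_segment[OF LIMSEQ_inverse_real_of_nat])
  then have h0: "filterlim h (at 0) sequentially"
    by (rule filterlim_atI) (simp add: h_def)
  let ?q = "\<lambda>n t. (\<Sum>i<d. (2 * sin (h n * t i / 2) / h n)\<^sup>2) * B_fun d t"
  have sinc: "(\<lambda>n. 2 * sin (h n * a / 2) / h n) \<longlonglongrightarrow> a" for a :: real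
  proof -
    have "((\<lambda>s. 2 * sin (s * a / 2)) has_real_derivative a) (at 0)"
      by (auto intro!: derivative_eq_intros)
    then have "((\<lambda>s. 2 * sin (s * a / 2) / s) \<longlongrightarrow> a) (at 0)"
      by (simp add: DERIV_def)
    then show ?thesis by (rule filterlim_compose) (rule h0)
  qed
  have "(\<lambda>n. ?q n t) \<longlonglongrightarrow> sqnorm d t * B_fun d t" for t
    by (intro tendsto_intros sinc)
  then have "liminf (\<lambda>n. ennreal (?q n t)) = ennreal (sqnorm d t * B_fun d t)" for t
    by (intro lim_imp_Liminf tendsto_ennrealI) simp
  then have "(\<integral>\<^sup>+t. ennreal (sqnorm d t * B_fun d t) \<partial>?L) = (\<integral>\<^sup>+t. liminf (\<lambda>n. ennreal (?q n t)) \<partial>?L)"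
    by simp
  also have "\<dots> \<le> liminf (\<lambda>n. \<integral>\<^sup>+t. ennreal (?q n t) \<partial>?L)"
  proof (rule nn_integral_liminf)
    fix n
    have [measurable]: "(\<lambda>t. \<Sum>i<d. (2 * sin (h n * t i / 2) / h n)\<^sup>2) \<in> borel_measurable ?L"
    proof (rule borel_measurable_sum)
      fix i assume "i \<in> {..<d}"
      then have [measurable]: "(\<lambda>t. t i) \<in> borel_measurable ?L"
        using component_measurable_lborel_Rd[of "\<lambda>x. x" ?L d i] by simp
      show "(\<lambda>t. (2 * sin (h n * t i / 2) / h n)\<^sup>2) \<in> borel_measurable ?L"
        by measurable
    qed
    show "(\<lambda>t. ennreal (?q n t)) \<in> borel_measurable ?L" by measurable
  qed
  also have "\<dots> \<le> limsup (\<lambda>n. \<integral>\<^sup>+t. ennreal (?q n t) \<partial>?L)"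
    by (rule Liminf_le_Limsup) simp
  also have "\<dots> \<le> ennreal (320 * (real d + 1)\<^sup>2)"
    by (rule Limsup_bounded) (intro always_eventually allI difference_quotient_moment h)
  also have "\<dots> \<le> ennreal (1280 * (real d)\<^sup>2)"
  proof (rule ennreal_leI)
    have "(real d + 1)\<^sup>2 \<le> (2 * real d)\<^sup>2"
      using False by (intro power_mono) simp_all
    then show "320 * (real d + 1)\<^sup>2 \<le> 1280 * (real d)\<^sup>2"
      by (simp add: power_mult_distrib)
  qed
  finally show ?thesis .
qed simp

section \<open>Lebesgue measurable functions and the main estimates\<close>

lemma distr_reflect: "distr (lborel_Rd d) (lborel_Rd d) (vaff d a (- 1)) = lborel_Rd d"
  using lborel_Rd_affine[of "- 1" d a] by (simp add: density_1)

lemma vsub_eq_vaff: "vsub d x y = vaff d x (- 1) y"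
  by (simp add: vsub_def vaff_def)

lemma vscale_eq_vaff: "vscale d c y = vaff d (\<lambda>_. 0) c y"
  by (simp add: vscale_def vaff_def)

text \<open>Lebesgue measurability survives composition only with maps that pull null sets back to
  null sets; the reflection does, as it preserves the measure.\<close>

lemma measurable_reflect_leb:
  assumes "F \<in> borel_measurable (leb d)"
  shows "(\<lambda>y. F (vsub d x y)) \<in> borel_measurable (leb d)"
proof -
  have "vaff d x (- 1) \<in> leb d \<rightarrow>\<^sub>M leb d"
    unfolding leb_def
    by (rule completion.measurable_completion2)
       (simp_all add: measurable_completion distr_completion distr_reflect)
  then show ?thesis
    unfolding vsub_eq_vaff by (rule measurable_compose) (rule assms)
qed

lemma B_scaled_measurable [measurable]: "B_scaled d c \<in> borel_measurable (lborel_Rd d)"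
  unfolding B_scaled_def[abs_def] vscale_eq_vaff by measurable

lemma B_scaled_nonneg: "0 < c \<Longrightarrow> 0 \<le> B_scaled d c y"
  by (simp add: B_scaled_def B_fun_eq)

lemma nn_integral_B_scaled: "0 < c \<Longrightarrow> (\<integral>\<^sup>+y. ennreal (B_scaled d c y) \<partial>lborel_Rd d) = 1"
proof -
  assume c: "0 < c"
  have "(\<integral>\<^sup>+y. ennreal (B_scaled d c y) \<partial>lborel_Rd d)
      = (\<integral>\<^sup>+y. ennreal (\<bar>c\<bar> ^ d) * ennreal (B_fun d (vaff d (\<lambda>_. 0) c y)) \<partial>lborel_Rd d)"
    using c by (intro nn_integral_cong) (simp add: B_scaled_def vscale_eq_vaff B_fun_eq ennreal_mult)
  also have "\<dots> = ennreal (\<bar>c\<bar> ^ d) * (\<integral>\<^sup>+y. ennreal (B_fun d (vaff d (\<lambda>_. 0) c y)) \<partial>lborel_Rd d)"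
    by (rule nn_integral_cmult) measurable
  also have "\<dots> = (\<integral>\<^sup>+y. ennreal (B_fun d y) \<partial>lborel_Rd d)"
    by (rule nn_integral_affine_Rd[where h="\<lambda>y. ennreal (B_fun d y)"]) (use c in auto)
  finally show ?thesis by (simp add: nn_integral_B_fun)
qed

text \<open>On the tail 1 \<le> |y|^2 / \<delta>^2, and |y|^2 = |c y|^2 / c^2 reduces the rest to
  the second moment of \<open>B\<close>. The strict inequality complements the closed ball in the
  hypothesis of (ii).\<close>

lemma B_scaled_tail:
  assumes c: "0 < c" and \<delta>: "0 < \<delta>"
  shows "(\<integral>\<^sup>+y. ennreal (B_scaled d c y) * indicator {y. \<delta>\<^sup>2 < sqnorm d y} y \<partial>lborel_Rd d)
    \<le> ennreal (1280 * (real d)\<^sup>2 / (c\<^sup>2 * \<delta>\<^sup>2))"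
proof -
  let ?L = "lborel_Rd d" and ?g = "\<lambda>t. ennreal (sqnorm d t * B_fun d t)"
  let ?A = "1 / (c\<^sup>2 * \<delta>\<^sup>2)"
  have [measurable]: "?g \<in> borel_measurable ?L" by measurable
  have "(\<integral>\<^sup>+y. ennreal (B_scaled d c y) * indicator {y. \<delta>\<^sup>2 < sqnorm d y} y \<partial>?L)
      \<le> (\<integral>\<^sup>+y. ennreal ?A * (ennreal (\<bar>c\<bar> ^ d) * ?g (vaff d (\<lambda>_. 0) c y)) \<partial>?L)"
  proof (rule nn_integral_mono)
    fix y
    show "ennreal (B_scaled d c y) * indicator {y. \<delta>\<^sup>2 < sqnorm d y} y
        \<le> ennreal ?A * (ennreal (\<bar>c\<bar> ^ d) * ?g (vaff d (\<lambda>_. 0) c y))"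
    proof (cases "\<delta>\<^sup>2 < sqnorm d y")
      case True
      let ?b = "B_fun d (vaff d (\<lambda>_. 0) c y)"
      have b: "0 \<le> ?b" by (simp add: B_fun_eq)
      have "sqnorm d (vaff d (\<lambda>_. 0) c y) = c\<^sup>2 * sqnorm d y"
        by (simp add: power_mult_distrib sum_distrib_left)
      then have eq: "?A * (\<bar>c\<bar> ^ d * (sqnorm d (vaff d (\<lambda>_. 0) c y) * ?b)) = (sqnorm d y / \<delta>\<^sup>2) * (c ^ d * ?b)"
        using c by simp
      have "1 * (c ^ d * ?b) \<le> (sqnorm d y / \<delta>\<^sup>2) * (c ^ d * ?b)"
        using True \<delta> c b by (intro mult_right_mono) simp_all
      then have "B_scaled d c y \<le> ?A * (\<bar>c\<bar> ^ d * (sqnorm d (vaff d (\<lambda>_. 0) c y) * ?b))"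
        unfolding eq by (simp add: B_scaled_def vscale_eq_vaff)
      then have "ennreal (B_scaled d c y) \<le> ennreal (?A * (\<bar>c\<bar> ^ d * (sqnorm d (vaff d (\<lambda>_. 0) c y) * ?b)))"
        by (rule ennreal_leI)
      also have "\<dots> = ennreal ?A * (ennreal (\<bar>c\<bar> ^ d) * ?g (vaff d (\<lambda>_. 0) c y))"
        using b sqnorm_nonneg[of "vaff d (\<lambda>_. 0) c y" d] by (simp only: ennreal_mult mult_nonneg_nonneg zero_le_power abs_ge_zero zero_le_divide_1_iff zero_le_power2)
      finally show ?thesis using True by simp
    qed simp
  qed
  also have "\<dots> = ennreal ?A * (ennreal (\<bar>c\<bar> ^ d) * (\<integral>\<^sup>+y. ?g (vaff d (\<lambda>_. 0) c y) \<partial>?L))"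
    by (simp only: nn_integral_cmult[OF measurable_compose[OF measurable_vaff \<open>?g \<in> borel_measurable ?L\<close>]]
        nn_integral_cmult[OF borel_measurable_times_ennreal[OF borel_measurable_const measurable_compose[OF measurable_vaff \<open>?g \<in> borel_measurable ?L\<close>]]])
  also have "\<dots> = ennreal ?A * (\<integral>\<^sup>+t. ?g t \<partial>?L)"
    by (subst nn_integral_affine_Rd[where h="?g"]) (use c in auto)
  also have "\<dots> \<le> ennreal ?A * ennreal (1280 * (real d)\<^sup>2)"
    by (intro mult_left_mono second_moment_B) simp
  also have "\<dots> = ennreal (1280 * (real d)\<^sup>2 / (c\<^sup>2 * \<delta>\<^sup>2))"
    by (subst ennreal_mult[symmetric]) simp_all
  finally show ?thesis .
qed

text \<open>The mollification sees \<open>F\<close> only up to null sets, because the reflection y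
  -> x - y keeps null sets null. All integrals can so be taken over the uncompleted measure.\<close>

lemma mollify_borel_representative:
  assumes F: "F \<in> borel_measurable (leb d)" and M: "\<And>x. x \<in> Rd d \<Longrightarrow> \<bar>F x\<bar> \<le> M"
  obtains G where "G \<in> borel_measurable (lborel_Rd d)" "\<And>x. \<bar>G x\<bar> \<le> M"
    "AE x in lborel_Rd d. F x = G x"
    "\<And>c x. mollify d c F x = (\<integral>y. B_scaled d c y * G (vaff d x (- 1) y) \<partial>lborel_Rd d)"
proof -
  obtain F' where F' [measurable]: "F' \<in> borel_measurable (lborel_Rd d)" and AE': "AE x in lborel_Rd d. F x = F' x"
    using completion_ex_borel_measurable_real[of F "lborel_Rd d"] F unfolding leb_def by blast
  \<comment> \<open>\<open>F'\<close> agrees with \<open>F\<close> only almost everywhere and may be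
    unbounded on the exceptional set; clipping restores the bound at every point.\<close>
  define G where "G x = max (- M) (min M (F' x))" for x
  have "\<bar>F (\<lambda>i\<in>{..<d}. 0)\<bar> \<le> M" by (rule M) simp
  then have "0 \<le> M" by linarith
  have Gm [measurable]: "G \<in> borel_measurable (lborel_Rd d)" unfolding G_def[abs_def] by measurable
  have AE: "AE x in lborel_Rd d. F x = G x"
    using AE' AE_space
  proof eventually_elim
    case (elim x)
    then have "\<bar>F' x\<bar> \<le> M" using M[of x] by (simp add: space_PiM)
    then show ?case using elim(1) by (simp add: G_def)
  qed
  have "mollify d c F x = (\<integral>y. B_scaled d c y * G (vaff d x (- 1) y) \<partial>lborel_Rd d)" for c x
  proof -
    have "mollify d c F x = (\<integral>y. B_scaled d c y * G (vaff d x (- 1) y) \<partial>leb d)"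
      unfolding mollify_def
    proof (rule integral_cong_AE)
      have B: "B_scaled d c \<in> borel_measurable (leb d)"
        unfolding leb_def by (rule measurable_completion) measurable
      show "(\<lambda>y. B_scaled d c y * F (vsub d x y)) \<in> borel_measurable (leb d)"
        by (rule borel_measurable_times[OF B measurable_reflect_leb[OF F]])
      show "(\<lambda>y. B_scaled d c y * G (vaff d x (- 1) y)) \<in> borel_measurable (leb d)"
        unfolding leb_def by (rule measurable_completion) measurable
      have "AE y in lborel_Rd d. F (vaff d x (- 1) y) = G (vaff d x (- 1) y)"
        by (rule AE_affine_Rd[OF AE]) simp
      then show "AE y in leb d. B_scaled d c y * F (vsub d x y) = B_scaled d c y * G (vaff d x (- 1) y)"
        unfolding leb_def vsub_eq_vaff by (intro AE_completion) (auto elim: eventually_mono)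
    qed
    also have "\<dots> = (\<integral>y. B_scaled d c y * G (vaff d x (- 1) y) \<partial>lborel_Rd d)"
      unfolding leb_def by (rule integral_completion) measurable
    finally show ?thesis .
  qed
  moreover have "\<bar>G x\<bar> \<le> M" for x using \<open>0 \<le> M\<close> by (auto simp: G_def abs_le_iff)
  ultimately show ?thesis using that Gm AE by blast
qed

lemma mollify_partials:
  assumes F: "F \<in> borel_measurable (leb d)" and M: "\<And>x. x \<in> Rd d \<Longrightarrow> \<bar>F x\<bar> \<le> M"
    and c: "0 < c" and "is": "set is \<subseteq> {..<d}"
  shows "has_partials d is (mollify d c F)"
    and "\<And>x. x \<in> Rd d \<Longrightarrow> \<bar>foldr partial is (mollify d c F) x\<bar> \<le> M * (2 * c) ^ length is"
proof -
  obtain G where G [measurable]: "G \<in> borel_measurable (lborel_Rd d)" and GM: "\<And>x. \<bar>G x\<bar> \<le> M"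
    and moll: "\<And>c x. mollify d c F x = (\<integral>y. B_scaled d c y * G (vaff d x (- 1) y) \<partial>lborel_Rd d)"
    by (rule mollify_borel_representative[OF F M]; blast)
  interpret bounded_measurable d G M c by unfold_locales (use G GM c in auto)
  have "mollify d c F x = conv_der [] x" if x: "x \<in> Rd d" for x
  proof -
    \<comment> \<open>The measure-preserving involution y -> x - y moves \<open>x\<close> out of the
      merely measurable function and into the kernel.\<close>
    let ?h = "\<lambda>y. B_scaled d c (vaff d x (- 1) y) * G y"
    have "(\<integral>y. ?h (vaff d x (- 1) y) \<partial>lborel_Rd d) = mollify d c F x"
      unfolding moll
    proof (intro Bochner_Integration.integral_cong refl)
      fix y assume "y \<in> space (lborel_Rd d)"
      then have "y \<in> extensional {..<d}" by (simp add: space_PiM PiE_def)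
      then have "vaff d x (- 1) (vaff d x (- 1) y) = y"
        by (intro extensionalityI[of _ "{..<d}"]) (simp_all add: vaff_def)
      then show "?h (vaff d x (- 1) y) = B_scaled d c y * G (vaff d x (- 1) y)" by simp
    qed
    moreover have "\<bar>- 1\<bar> ^ d *\<^sub>R (\<integral>y. ?h (vaff d x (- 1) y) \<partial>lborel_Rd d) = (\<integral>y. ?h y \<partial>lborel_Rd d)"
      by (rule integral_affine_Rd) simp_all
    ultimately have "mollify d c F x = (\<integral>y. ?h y \<partial>lborel_Rd d)" by simp
    also have "\<dots> = (\<integral>y. c ^ d * (G y * Bder d [] {#} {#} (vaff d (\<lambda>i. c * x i) (- c) y)) \<partial>lborel_Rd d)"
    proof (intro Bochner_Integration.integral_cong refl)
      fix y
      have "vscale d c (vaff d x (- 1) y) = vaff d (\<lambda>i. c * x i) (- c) y"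
        by (simp add: vscale_def vaff_def right_diff_distrib cong: restrict_cong)
      then show "?h y = c ^ d * (G y * Bder d [] {#} {#} (vaff d (\<lambda>i. c * x i) (- c) y))"
        by (simp add: B_scaled_def B_fun_eq power2_eq_square)
    qed
    also have "\<dots> = conv_der [] x"
      by (simp add: conv_der_def)
    finally show ?thesis .
  qed
  from partials_conv_der[OF this "is"]
  have *: "has_partials d is (mollify d c F)" "\<forall>x\<in>Rd d. foldr partial is (mollify d c F) x = conv_der is x"
    by blast+
  show "has_partials d is (mollify d c F)" by (rule *(1))
  show "\<bar>foldr partial is (mollify d c F) x\<bar> \<le> M * (2 * c) ^ length is" if "x \<in> Rd d" for x
    using *(2) that conv_der_bound[OF "is", of x] by simp
qed

text \<open>The kernel has mass 1, so the error averages F(x - y) - F(x): at most \<epsilon> for |y|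
  \<le> \<delta>, at most 2 M beyond. \<open>F x\<close> keeps its actual value, since
  \<open>G x\<close> may differ from it. Leaving the tail bound \<open>T\<close> abstract lets the
  degenerate case \<delta> = 0 use the same estimate.\<close>

lemma mollify_approx:
  assumes F: "F \<in> borel_measurable (leb d)" and M: "\<And>x. x \<in> Rd d \<Longrightarrow> \<bar>F x\<bar> \<le> M"
    and c: "0 < c" and x: "x \<in> Rd d" and \<epsilon>: "0 \<le> \<epsilon>" and \<delta>: "0 \<le> \<delta>"
    and near: "\<And>y. y \<in> Rd d \<Longrightarrow> L2_set (vsub d x y) {..<d} \<le> \<delta> \<Longrightarrow> \<bar>F x - F y\<bar> \<le> \<epsilon>"
    and T: "(\<integral>\<^sup>+y. ennreal (B_scaled d c y) * indicator {y. \<delta>\<^sup>2 < sqnorm d y} y \<partial>lborel_Rd d) \<le> ennreal T" "0 \<le> T"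
  shows "\<bar>mollify d c F x - F x\<bar> \<le> \<epsilon> + 2 * M * T"
proof -
  let ?L = "lborel_Rd d" and ?B = "B_scaled d c" and ?I = "indicator {y. \<delta>\<^sup>2 < sqnorm d y} :: _ \<Rightarrow> ennreal"
  obtain G where G [measurable]: "G \<in> borel_measurable ?L" and GM: "\<And>x. \<bar>G x\<bar> \<le> M"
    and AE: "AE x in ?L. F x = G x"
    and moll: "\<And>c x. mollify d c F x = (\<integral>y. B_scaled d c y * G (vaff d x (- 1) y) \<partial>lborel_Rd d)"
    by (rule mollify_borel_representative[OF F M]; blast)
  have M0: "0 \<le> M" using M[OF x] by linarith
  have B0: "0 \<le> ?B y" for y by (rule B_scaled_nonneg[OF c])
  have intB: "integrable ?L ?B"
    using nn_integral_B_scaled[OF c, of d] B0 by (intro integrableI_nonneg) auto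
  have B1: "(\<integral>y. ?B y \<partial>?L) = 1"
    using nn_integral_B_scaled[OF c, of d] B0 by (simp add: integral_eq_nn_integral)
  have Gv [measurable]: "(\<lambda>y. G (vaff d x (- 1) y)) \<in> borel_measurable ?L" by measurable
  have intBG: "integrable ?L (\<lambda>y. ?B y * G (vaff d x (- 1) y))"
  proof (rule Bochner_Integration.integrable_bound)
    show "integrable ?L (\<lambda>y. M * ?B y)" using intB by simp
    show "AE y in ?L. norm (?B y * G (vaff d x (- 1) y)) \<le> norm (M * ?B y)"
    proof (rule AE_I2)
      fix y
      show "norm (?B y * G (vaff d x (- 1) y)) \<le> norm (M * ?B y)"
        using mult_left_mono[OF GM[of "vaff d x (- 1) y"] B0[of y]] M0 B0[of y] by (simp add: abs_mult mult.commute)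
    qed
  qed measurable
  let ?D = "\<lambda>y. ?B y * G (vaff d x (- 1) y) - F x * ?B y"
  have intD: "integrable ?L ?D" using intBG intB by simp
  have "mollify d c F x - F x = (\<integral>y. ?D y \<partial>?L)"
    using intBG intB by (simp add: moll B1)
  then have "ennreal \<bar>mollify d c F x - F x\<bar> \<le> (\<integral>\<^sup>+y. ennreal (norm (?D y)) \<partial>?L)"
    using integral_norm_bound_ennreal[OF intD] by simp
  also have "\<dots> \<le> (\<integral>\<^sup>+y. ennreal \<epsilon> * ennreal (?B y) + ennreal (2 * M) * (ennreal (?B y) * ?I y) \<partial>?L)"
  proof (rule nn_integral_mono_AE)
    have "AE y in ?L. F (vaff d x (- 1) y) = G (vaff d x (- 1) y)"
      by (rule AE_affine_Rd[OF AE]) simp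
    then show "AE y in ?L. ennreal (norm (?D y)) \<le> ennreal \<epsilon> * ennreal (?B y) + ennreal (2 * M) * (ennreal (?B y) * ?I y)"
    proof eventually_elim
      case (elim y)
      let ?z = "vaff d x (- 1) y"
      have "?D y = ?B y * (F ?z - F x)"
        by (simp add: elim right_diff_distrib mult.commute)
      then have eq: "norm (?D y) = ?B y * \<bar>F x - F ?z\<bar>"
        using B0[of y] by (simp add: abs_mult abs_minus_commute)
      show ?case
      proof (cases "\<delta>\<^sup>2 < sqnorm d y")
        case True
        have "\<bar>F x - F ?z\<bar> \<le> 2 * M"
          using M[OF x] M[of ?z] by simp
        then have "norm (?D y) \<le> \<epsilon> * ?B y + 2 * M * ?B y"
          unfolding eq using mult_left_mono[of "\<bar>F x - F ?z\<bar>" "2 * M" "?B y"] B0[of y] \<epsilon>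
          by (simp add: mult.commute add_increasing)
        then have "ennreal (norm (?D y)) \<le> ennreal (\<epsilon> * ?B y + 2 * M * ?B y)"
          by (rule ennreal_leI)
        then show ?thesis
          using True B0[of y] \<epsilon> M0 by (simp add: ennreal_mult)
      next
        case False
        have "L2_set (vsub d x ?z) {..<d} = L2_set y {..<d}"
          by (intro L2_set_cong refl) (simp add: vsub_eq_vaff)
        also have "\<dots> \<le> \<delta>"
          unfolding L2_set_def using False \<delta> by (intro real_le_lsqrt) simp_all
        finally have "\<bar>F x - F ?z\<bar> \<le> \<epsilon>" by (intro near) simp_all
        then have "norm (?D y) \<le> \<epsilon> * ?B y"
          unfolding eq using mult_left_mono[of "\<bar>F x - F ?z\<bar>" \<epsilon> "?B y"] B0[of y] by (simp add: mult.commute)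
        then have "ennreal (norm (?D y)) \<le> ennreal (\<epsilon> * ?B y)"
          by (rule ennreal_leI)
        then show ?thesis
          using False B0[of y] \<epsilon> by (simp add: ennreal_mult)
      qed
    qed
  qed
  also have "\<dots> = ennreal \<epsilon> * (\<integral>\<^sup>+y. ennreal (?B y) \<partial>?L) + ennreal (2 * M) * (\<integral>\<^sup>+y. ennreal (?B y) * ?I y \<partial>?L)"
  proof -
    have [measurable]: "?I \<in> borel_measurable ?L"
    proof -
      have "(\<lambda>y. sqnorm d y) \<in> borel_measurable ?L" by measurable
      then have "(\<lambda>y. indicator {s. \<delta>\<^sup>2 < s} (sqnorm d y) :: ennreal) \<in> borel_measurable ?L" by measurable
      then show ?thesis by (simp add: indicator_def)
    qed
    show ?thesis
      by (subst nn_integral_add) (simp_all add: nn_integral_cmult)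
  qed
  also have "\<dots> \<le> ennreal \<epsilon> * 1 + ennreal (2 * M) * ennreal T"
    by (intro add_mono mult_left_mono T(1)) (simp_all add: nn_integral_B_scaled[OF c])
  also have "\<dots> = ennreal (\<epsilon> + 2 * M * T)"
    using \<epsilon> M0 T(2) by (simp add: ennreal_mult)
  finally show ?thesis
    by (rule ennreal_le_iff[THEN iffD1, rotated]) (use \<epsilon> M0 T(2) in simp)
qed

section \<open>Multi-indices, the supremum norm and the assembly of both claims\<close>

lemma length_dirs: "length (dirs d \<beta>) = (\<Sum>i<d. \<beta> i)"
  by (simp add: dirs_def length_concat o_def sum_list_sum_nth atLeast0LessThan)

lemma set_dirs: "set (dirs d \<beta>) \<subseteq> {..<d}"
  by (auto simp: dirs_def)

lemma sup_norm_real: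
  assumes "bounded (F ` Rd d)"
  obtains M where "sup_norm d F = ereal M" "0 \<le> M" "\<And>x. x \<in> Rd d \<Longrightarrow> \<bar>F x\<bar> \<le> M"
proof -
  obtain A where A: "\<And>x. x \<in> Rd d \<Longrightarrow> \<bar>F x\<bar> \<le> A"
    using assms by (auto simp: bounded_iff)
  have le: "ereal \<bar>F x\<bar> \<le> sup_norm d F" if "x \<in> Rd d" for x
    unfolding sup_norm_def by (rule SUP_upper[OF that])
  have "sup_norm d F \<le> ereal A"
    unfolding sup_norm_def by (rule SUP_least) (simp add: A)
  moreover have "0 \<le> sup_norm d F"
  proof -
    have "0 \<le> ereal \<bar>F (\<lambda>i\<in>{..<d}. 0)\<bar>" by simp
    also have "\<dots> \<le> sup_norm d F" by (rule le) simp
    finally show ?thesis .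
  qed
  ultimately obtain M where M: "sup_norm d F = ereal M" "0 \<le> M"
    by (cases "sup_norm d F") auto
  then show ?thesis using that le by simp
qed

theorem theorem4p7:
  "\<exists>K::real. K > 0 \<and>
    (\<forall>(d::nat) (F :: (nat \<Rightarrow> real) \<Rightarrow> real) (c::real).
      F \<in> borel_measurable (leb d) \<and> bounded (F ` Rd d) \<and> c > 0 \<longrightarrow>
      (\<forall>\<beta> :: nat \<Rightarrow> nat.
         has_multi_partial d \<beta> (mollify d c F) \<and>
         sup_norm d (multi_partial d \<beta> (mollify d c F))
           \<le> sup_norm d F * ereal ((2 * c) ^ (\<Sum>i<d. \<beta> i))) \<and>
      (\<forall>x\<in>Rd d. \<forall>\<epsilon> \<delta> :: real.
         \<epsilon> \<ge> 0 \<and> \<delta> \<ge> 0 \<and>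
         (\<forall>y\<in>Rd d. L2_set (vsub d x y) {..<d} \<le> \<delta> \<longrightarrow> \<bar>F x - F y\<bar> \<le> \<epsilon>) \<longrightarrow>
         ereal \<bar>mollify d c F x - F x\<bar>
           \<le> ereal \<epsilon> + sup_norm d F *
               (ereal K * (ereal ((real d)\<^sup>2) / ereal (c\<^sup>2 * \<delta>\<^sup>2)))))"
proof (intro exI[of _ 2560] conjI allI impI ballI)
  fix d :: nat and F :: "(nat \<Rightarrow> real) \<Rightarrow> real" and c :: real
  assume "F \<in> borel_measurable (leb d) \<and> bounded (F ` Rd d) \<and> c > 0"
  then have F: "F \<in> borel_measurable (leb d)" and bdd: "bounded (F ` Rd d)" and c: "0 < c" by auto
  obtain M where norm: "sup_norm d F = ereal M" and M0: "0 \<le> M" and M: "\<And>x. x \<in> Rd d \<Longrightarrow> \<bar>F x\<bar> \<le> M"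
    by (rule sup_norm_real[OF bdd]) blast
  show "has_multi_partial d \<beta> (mollify d c F)" for \<beta>
    unfolding has_multi_partial_def by (rule mollify_partials(1)[OF F M c set_dirs])
  show "sup_norm d (multi_partial d \<beta> (mollify d c F)) \<le> sup_norm d F * ereal ((2 * c) ^ (\<Sum>i<d. \<beta> i))" for \<beta>
  proof -
    have "sup_norm d (multi_partial d \<beta> (mollify d c F)) \<le> ereal (M * (2 * c) ^ (\<Sum>i<d. \<beta> i))"
      unfolding sup_norm_def multi_partial_def length_dirs[symmetric]
      by (rule SUP_least, unfold ereal_less_eq(3)) (rule mollify_partials(2)[OF F M c set_dirs])
    then show ?thesis by (simp add: norm)
  qed
  fix x \<epsilon> \<delta> assume x: "x \<in> Rd d"
    and A: "\<epsilon> \<ge> 0 \<and> \<delta> \<ge> 0 \<and> (\<forall>y\<in>Rd d. L2_set (vsub d x y) {..<d} \<le> \<delta> \<longrightarrow> \<bar>F x - F y\<bar> \<le> \<epsilon>)"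
  then have \<epsilon>: "0 \<le> \<epsilon>" and \<delta>: "0 \<le> \<delta>"
    and near: "\<And>y. y \<in> Rd d \<Longrightarrow> L2_set (vsub d x y) {..<d} \<le> \<delta> \<Longrightarrow> \<bar>F x - F y\<bar> \<le> \<epsilon>" by blast+
  note approx = mollify_approx[OF F M c x \<epsilon> \<delta> near]
  let ?goal = "ereal \<bar>mollify d c F x - F x\<bar>
    \<le> ereal \<epsilon> + sup_norm d F * (ereal 2560 * (ereal ((real d)\<^sup>2) / ereal (c\<^sup>2 * \<delta>\<^sup>2)))"
  \<comment> \<open>For \<open>\<delta> = 0\<close> the quotient is \<open>0\<close> if \<open>d = 0\<close> (as \<open>0 / 0 = 0\<close> in \<open>ereal\<close>) and \<open>\<infinity>\<close> otherwise.\<close>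
  consider "0 < \<delta>" | "\<delta> = 0" "M = 0" | "\<delta> = 0" "d = 0" | "\<delta> = 0" "0 < M" "d \<noteq> 0"
    using \<delta> M0 by fastforce
  then show ?goal
  proof cases
    case 1
    then have "\<bar>mollify d c F x - F x\<bar> \<le> \<epsilon> + 2 * M * (1280 * (real d)\<^sup>2 / (c\<^sup>2 * \<delta>\<^sup>2))"
      by (intro approx B_scaled_tail c) simp_all
    moreover have "c\<^sup>2 * \<delta>\<^sup>2 \<noteq> 0" using 1 c by simp
    ultimately show ?thesis
      unfolding norm by (simp add: mult_ac)
  next
    case 2
    \<comment> \<open>In \<open>ereal\<close>, 0 times \<infinity> is 0, so the estimate has to give
      \<epsilon> alone. The trivial tail bound 1 achieves this, as it is multiplied by 2 M =
      0.\<close>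
    have "(\<integral>\<^sup>+y. ennreal (B_scaled d c y) * indicator {y. \<delta>\<^sup>2 < sqnorm d y} y \<partial>lborel_Rd d)
        \<le> (\<integral>\<^sup>+y. ennreal (B_scaled d c y) \<partial>lborel_Rd d)"
      by (intro nn_integral_mono) (simp add: indicator_def)
    then have "\<bar>mollify d c F x - F x\<bar> \<le> \<epsilon> + 2 * M * 1"
      by (intro approx) (simp_all add: nn_integral_B_scaled[OF c])
    then show ?thesis
      using 2 by (simp add: norm zero_ereal_def[symmetric])
  next
    case 3
    \<comment> \<open>In dimension 0 the squared norm is an empty sum, hence never above \<delta>^2:
      the tail is empty and \<open>T = 0\<close>.\<close>
    then have "\<bar>mollify d c F x - F x\<bar> \<le> \<epsilon> + 2 * M * 0"
      by (intro approx) simp_all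
    then show ?thesis
      using 3 by (simp add: norm divide_ereal_def zero_ereal_def[symmetric])
  next
    case 4
    then have inf: "sup_norm d F * (ereal 2560 * (ereal ((real d)\<^sup>2) / ereal (c\<^sup>2 * \<delta>\<^sup>2))) = \<infinity>"
      by (simp add: norm divide_ereal_def zero_ereal_def[symmetric])
    show ?thesis unfolding inf by simp
  qed
qed simp

end
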